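(* Let $\mathfrak k$ be a commutative ring, $A=\mathfrak k\langle x_1,\dots,x_n\rangle$ the free associative algebra and $\bar A$ its ideal generated by $x_1,\dots,x_n$. Let $A^{\rm rat}_{\bar A}$ and $A^{\rm alg}_{\bar A}$ be the rational closure and the algebraic closure of $A$ in the power series algebra $\Gamma=\mathfrak k\langle\langle x_1,\dots,x_n\rangle\rangle$ in non-commuting variables. Then the module type of both Leavitt localizations $L(A^{\rm rat}_{\bar A})$ and $L(A^{\rm alg}_{\bar A})$, inverting universally the row $(x_1,\dots,x_n)$, is $(1,n)$ if $n\ge2$.
   Context: Rings have a nonzero multiplicative identity. For $r\in\Gamma$ with zero constant term, its quasi-inverse is $r^+=\sum_{m\ge1}r^m$. $A^{\rm rat}_{\bar A}$ is the smallest subalgebra of $\Gamma$ containing $A$ and closed under quasi-inverses of its elements with zero constant term. $A^{\rm alg}_{\bar A}$ is the algebra of algebraic power series (in Cohn's sense): those of the form $c+u_1$ with $c\in\mathfrak k$ and $u_1$ the first component of the unique solution $(u_1,\dots,u_m)$, with all $u_i\in\Gamma$ of zero constant term, of a system $u_i=\varphi_i(u_1,\dots,u_m,x_1,\dots,x_n)$ ($i=1,\dots,m$), where the $\varphi_i$ are non-commutative polynomials over $\mathfrak k$ without constant term and without terms of degree $1$ that are scalar multiples of a single $u_j$. For an algebra $R$ containing $x_1,\dots,x_n$, $L(R)$ is the algebra generated over $R$ by $x_1^*,\dots,x_n^*$ subject to $x_i^*x_j=\delta_{ij}$ and $\sum_{i=1}^nx_ix_i^*=1$. For a ring $T$ without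 invariant basis number, the module type of $T$ is the unique pair $(p,q)$ of smallest possible positive integers $p\le q-1$ such that the free $T$-modules of ranks $p$ and $q$ are isomorphic. *)

theory Defs
  imports "HOL-Algebra.QuotRing" "HOL-Algebra.Module" "HOL-Library.FuncSet" "HOL-Library.Cardinality"
begin

section \<open>Power series in non-commuting variables\<close>

text \<open>
  The variables are indexed by the type \<open>'x\<close>; a series is the family of its coefficients at the
  words in \<open>'x\<close>, the empty word being the place of the constant term.
\<close>

typedef ('x, 'k) nc_series = "UNIV :: ('x list \<Rightarrow> 'k) set"
  morphisms nc_coeff Nc_Series ..

lemma nc_coeff_Nc_Series [simp]: "nc_coeff (Nc_Series f) = f"
  by (simp add: Nc_Series_inverse)

lemma nc_series_eqI: "(\<And>w. nc_coeff f w = nc_coeff g w) \<Longrightarrow> f = g"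
  by (metis nc_coeff_inject ext)

instantiation nc_series :: (type, ring_1) ring_1
begin

definition zero_nc_series :: "('a, 'b) nc_series"
  where "0 = Nc_Series (\<lambda>w. 0)"

definition one_nc_series :: "('a, 'b) nc_series"
  where "1 = Nc_Series (\<lambda>w. if w = [] then 1 else 0)"

definition plus_nc_series :: "('a, 'b) nc_series \<Rightarrow> ('a, 'b) nc_series \<Rightarrow> ('a, 'b) nc_series"
  where "f + g = Nc_Series (\<lambda>w. nc_coeff f w + nc_coeff g w)"

definition minus_nc_series :: "('a, 'b) nc_series \<Rightarrow> ('a, 'b) nc_series \<Rightarrow> ('a, 'b) nc_series"
  where "f - g = Nc_Series (\<lambda>w. nc_coeff f w - nc_coeff g w)"

definition uminus_nc_series :: "('a, 'b) nc_series \<Rightarrow> ('a, 'b) nc_series"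
  where "- f = Nc_Series (\<lambda>w. - nc_coeff f w)"

definition times_nc_series :: "('a, 'b) nc_series \<Rightarrow> ('a, 'b) nc_series \<Rightarrow> ('a, 'b) nc_series"
  where "f * g =
    Nc_Series (\<lambda>w. \<Sum>i\<le>length w. nc_coeff f (take i w) * nc_coeff g (drop i w))"

instance
proof
  fix f g h :: "('a, 'b) nc_series"
  show "f * g * h = f * (g * h)"
  proof (rule nc_series_eqI)
    fix w :: "'a list"
    define n where "n = length w"
    define t where "t j k = nc_coeff f (take j w) * nc_coeff g (take k (drop j w))
                * nc_coeff h (drop (k + j) w)" for j k
    have "nc_coeff (f * g * h) w = (\<Sum>i\<le>n. \<Sum>j\<le>i. t j (i - j))"
      unfolding times_nc_series_def nc_coeff_Nc_Series sum_distrib_right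
      by (intro sum.cong) (simp_all add: drop_take t_def n_def)
    also have "\<dots> = (\<Sum>(j, k)\<in>{(j, k). j + k \<le> n}. t j k)"
      by (rule sum.triangle_reindex_eq [symmetric])
    also have "{(j, k). j + k \<le> n} = (SIGMA j:{..n}. {..n - j})"
      by auto
    also have "(\<Sum>(j, k)\<in>(SIGMA j:{..n}. {..n - j}). t j k) = (\<Sum>j\<le>n. \<Sum>k\<le>n - j. t j k)"
      by (rule sum.Sigma [symmetric]) auto
    also have "\<dots> = nc_coeff (f * (g * h)) w"
      unfolding times_nc_series_def nc_coeff_Nc_Series sum_distrib_left
      by (intro sum.cong) (simp_all add: mult.assoc t_def n_def)
    finally show "nc_coeff (f * g * h) w = nc_coeff (f * (g * h)) w" .
  qed
  show "1 * f = f"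
  proof (rule nc_series_eqI)
    fix w :: "'a list"
    have "nc_coeff (1 * f) w = (\<Sum>i\<le>length w. if i = 0 then nc_coeff f w else 0)"
      unfolding times_nc_series_def one_nc_series_def nc_coeff_Nc_Series
      by (rule sum.cong) auto
    then show "nc_coeff (1 * f) w = nc_coeff f w" by simp
  qed
  show "f * 1 = f"
  proof (rule nc_series_eqI)
    fix w :: "'a list"
    have "nc_coeff (f * 1) w = (\<Sum>i\<le>length w. if i = length w then nc_coeff f w else 0)"
      unfolding times_nc_series_def one_nc_series_def nc_coeff_Nc_Series
      by (rule sum.cong) auto
    then show "nc_coeff (f * 1) w = nc_coeff f w" by simp
  qed
  have "nc_coeff (0 :: ('a, 'b) nc_series) [] \<noteq> nc_coeff (1 :: ('a, 'b) nc_series) []"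
    by (simp add: zero_nc_series_def one_nc_series_def)
  then show "(0 :: ('a, 'b) nc_series) \<noteq> 1"
    by auto
qed (auto simp: zero_nc_series_def plus_nc_series_def minus_nc_series_def uminus_nc_series_def
      times_nc_series_def algebra_simps sum.distrib intro!: nc_series_eqI)

end

definition nc_const :: "'k \<Rightarrow> ('x, 'k :: ring_1) nc_series"
  where "nc_const c = Nc_Series (\<lambda>w. if w = [] then c else 0)"

definition nc_var :: "'x \<Rightarrow> ('x, 'k :: ring_1) nc_series"
  where "nc_var x = Nc_Series (\<lambda>w. if w = [x] then 1 else 0)"

abbreviation nc_constant_term :: "('x, 'k) nc_series \<Rightarrow> 'k"
  where "nc_constant_term f \<equiv> nc_coeff f []"

section \<open>Non-commutative polynomials\<close>

definition nc_support :: "('x, 'k :: ring_1) nc_series \<Rightarrow> 'x list set"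
  where "nc_support f = {w. nc_coeff f w \<noteq> 0}"

text \<open>The free associative algebra on a set \<open>X\<close> of variables, inside the series.\<close>

definition nc_polys :: "'x set \<Rightarrow> ('x, 'k :: ring_1) nc_series set"
  where "nc_polys X = {f. finite (nc_support f) \<and> nc_support f \<subseteq> lists X}"

definition nc_poly_ring :: "'x set \<Rightarrow> ('x, 'k :: ring_1) nc_series ring"
  where "nc_poly_ring X =
    \<lparr>carrier = nc_polys X, mult = (*), one = 1, zero = 0, add = (+)\<rparr>"

lemma nc_polysI:
  assumes "nc_support f \<subseteq> W" and "finite W" and "W \<subseteq> lists X"
  shows "f \<in> nc_polys X"
  unfolding nc_polys_def using assms finite_subset[OF assms(1,2)] by blast

lemma nc_polys_add:
  assumes "f \<in> nc_polys X" and "g \<in> nc_polys X"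
  shows "f + g \<in> nc_polys X"
proof (rule nc_polysI)
  show "nc_support (f + g) \<subseteq> nc_support f \<union> nc_support g"
    by (auto simp: nc_support_def plus_nc_series_def)
qed (use assms in \<open>simp_all add: nc_polys_def\<close>)

lemma nc_polys_uminus: "f \<in> nc_polys X \<Longrightarrow> - f \<in> nc_polys X"
  by (simp add: nc_polys_def nc_support_def uminus_nc_series_def)

lemma nc_support_mult:
  "nc_support (f * g) \<subseteq> (\<lambda>(u, v). u @ v) ` (nc_support f \<times> nc_support g)"
proof
  fix w assume "w \<in> nc_support (f * g)"
  then obtain i where "nc_coeff f (take i w) * nc_coeff g (drop i w) \<noteq> 0"
    by (auto simp: nc_support_def times_nc_series_def elim: sum.not_neutral_contains_not_neutral)
  then have "take i w \<in> nc_support f" "drop i w \<in> nc_support g"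
    by (auto simp: nc_support_def)
  then show "w \<in> (\<lambda>(u, v). u @ v) ` (nc_support f \<times> nc_support g)"
    by (intro image_eqI[where x = "(take i w, drop i w)"]) auto
qed

lemma nc_polys_mult:
  assumes "f \<in> nc_polys X" and "g \<in> nc_polys X"
  shows "f * g \<in> nc_polys X"
proof (rule nc_polysI[OF nc_support_mult])
  show "(\<lambda>(u, v). u @ v) ` (nc_support f \<times> nc_support g) \<subseteq> lists X"
  proof (rule image_subsetI)
    fix p assume "p \<in> nc_support f \<times> nc_support g"
    then have "fst p \<in> lists X" "snd p \<in> lists X"
      using assms unfolding nc_polys_def by auto
    then show "(case p of (u, v) \<Rightarrow> u @ v) \<in> lists X"
      by (simp add: case_prod_beta)
  qed
qed (use assms in \<open>simp add: nc_polys_def\<close>)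

lemma nc_polys_0: "0 \<in> nc_polys X"
  by (simp add: nc_polys_def nc_support_def zero_nc_series_def)

lemma nc_polys_1: "(1 :: ('x, 'k :: ring_1) nc_series) \<in> nc_polys X"
proof -
  have "nc_support (1 :: ('x, 'k) nc_series) = {[]}"
    by (simp add: nc_support_def one_nc_series_def)
  then show ?thesis
    by (simp add: nc_polys_def)
qed

lemma ring_nc_poly_ring: "ring (nc_poly_ring X :: ('x, 'k :: ring_1) nc_series ring)"
proof (rule ringI)
  show "abelian_group (nc_poly_ring X :: ('x, 'k) nc_series ring)"
  proof (rule abelian_groupI)
    fix f :: "('x, 'k) nc_series"
    assume "f \<in> carrier (nc_poly_ring X)"
    then show "\<exists>g\<in>carrier (nc_poly_ring X).
        g \<oplus>\<^bsub>nc_poly_ring X\<^esub> f = \<zero>\<^bsub>nc_poly_ring X\<^esub>"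
      by (intro bexI[of _ "- f"]) (simp_all add: nc_poly_ring_def nc_polys_uminus)
  qed (simp_all add: nc_poly_ring_def nc_polys_add nc_polys_0 ac_simps)
  show "Group.monoid (nc_poly_ring X :: ('x, 'k) nc_series ring)"
    by (rule monoidI) (simp_all add: nc_poly_ring_def nc_polys_mult nc_polys_1 mult.assoc)
qed (simp_all add: nc_poly_ring_def distrib_left distrib_right)

section \<open>Rational and algebraic closure of the polynomials in the series\<close>

definition nc_subalgebra :: "('x, 'k :: ring_1) nc_series set \<Rightarrow> bool"
  where "nc_subalgebra S \<longleftrightarrow>
    (\<forall>c. nc_const c \<in> S) \<and> (\<forall>f\<in>S. \<forall>g\<in>S. f + g \<in> S \<and> f * g \<in> S)"

text \<open>
  The series \<open>\<Sum>m\<ge>1. r ^ m\<close> for \<open>r\<close> with zero constant term. By the following lemma only the powers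
  with exponent at most the length of \<open>w\<close> contribute to the coefficient at \<open>w\<close>.
\<close>

definition quasi_inverse :: "('x, 'k :: ring_1) nc_series \<Rightarrow> ('x, 'k) nc_series"
  where "quasi_inverse r = Nc_Series (\<lambda>w. \<Sum>m = 1..length w. nc_coeff (r ^ m) w)"

lemma nc_coeff_power_eq_0:
  assumes "nc_constant_term r = 0" and "length w < m"
  shows "nc_coeff (r ^ m) w = 0"
  using assms(2)
proof (induction m arbitrary: w)
  case (Suc m)
  have "nc_coeff r (take i w) * nc_coeff (r ^ m) (drop i w) = 0" if "i \<le> length w" for i
  proof (cases "i = 0")
    case True
    then show ?thesis using assms(1) by simp
  next
    case False
    with that Suc.prems have "length (drop i w) < m" by auto
    then show ?thesis by (simp add: Suc.IH)
  qed
  then show ?case by (simp add: times_nc_series_def)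
qed simp

definition nc_rational_closure :: "('x, 'k :: ring_1) nc_series set"
  where "nc_rational_closure = \<Inter> {S. nc_subalgebra S \<and> nc_polys UNIV \<subseteq> S \<and>
    (\<forall>r\<in>S. nc_constant_term r = 0 \<longrightarrow> quasi_inverse r \<in> S)}"

text \<open>
  In the polynomials \<open>\<phi>\<close> of an algebraic system the unknown \<open>u\<^sub>j\<close> is the variable \<open>Inl j\<close>,
  and \<open>x\<close> is the variable \<open>Inr x\<close>. Unknowns and equations are numbered from \<open>0\<close>.
\<close>

definition nc_subst ::
    "('y \<Rightarrow> ('x, 'k :: ring_1) nc_series) \<Rightarrow> ('y, 'k) nc_series \<Rightarrow> ('x, 'k) nc_series"
  where "nc_subst s p =
    (\<Sum>w\<in>nc_support p. nc_const (nc_coeff p w) * prod_list (map s w))"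

definition algebraic_system :: "nat \<Rightarrow> (nat \<Rightarrow> (nat + 'x, 'k :: ring_1) nc_series) \<Rightarrow> bool"
  where "algebraic_system m \<phi> \<longleftrightarrow> (\<forall>i<m.
    \<phi> i \<in> nc_polys (Inl ` {..<m} \<union> range Inr) \<and>
    nc_constant_term (\<phi> i) = 0 \<and>
    (\<forall>j<m. nc_coeff (\<phi> i) [Inl j] = 0))"

definition solves_algebraic_system ::
    "nat \<Rightarrow> (nat \<Rightarrow> (nat + 'x, 'k :: ring_1) nc_series) \<Rightarrow> (nat \<Rightarrow> ('x, 'k) nc_series) \<Rightarrow> bool"
  where "solves_algebraic_system m \<phi> u \<longleftrightarrow> (\<forall>i<m.
    nc_constant_term (u i) = 0 \<and> u i = nc_subst (case_sum u nc_var) (\<phi> i))"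

text \<open>
  The components \<open>u i\<close>, \<open>i < m\<close>, of a solution are uniquely determined by the system: the
  coefficients at words of length \<open>d\<close> are determined by those at shorter words.
\<close>

definition nc_algebraic_closure :: "('x, 'k :: ring_1) nc_series set"
  where "nc_algebraic_closure = {nc_const c + u 0 | c m \<phi> u.
    m \<ge> 1 \<and> algebraic_system m \<phi> \<and> solves_algebraic_system m \<phi> u}"

section \<open>Leavitt localization\<close>

text \<open>
  The algebra is presented by one generator \<open>base_gen r\<close> for every \<open>r \<in> R\<close> and one generator
  \<open>star_gen i\<close> for every variable. The first three families of relations express that \<open>base_gen\<close> is a
  homomorphism of unital algebras on \<open>R\<close>, so that \<open>R\<close> and the \<open>star_gen i\<close> are subject to the last two
  families only.
\<close>

abbreviation base_gen :: "('x, 'k) nc_series \<Rightarrow> (('x, 'k) nc_series + 'x, 'k :: ring_1) nc_series"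
  where "base_gen r \<equiv> nc_var (Inl r)"

abbreviation star_gen :: "'x \<Rightarrow> (('x, 'k) nc_series + 'x, 'k :: ring_1) nc_series"
  where "star_gen i \<equiv> nc_var (Inr i)"

definition leavitt_relations ::
    "('x :: finite, 'k :: ring_1) nc_series set \<Rightarrow> (('x, 'k) nc_series + 'x, 'k) nc_series set"
  where "leavitt_relations R =
    {base_gen (r + s) - (base_gen r + base_gen s) | r s. r \<in> R \<and> s \<in> R} \<union>
    {base_gen (r * s) - base_gen r * base_gen s | r s. r \<in> R \<and> s \<in> R} \<union>
    {base_gen (nc_const c) - nc_const c | c. True} \<union>
    {star_gen i * base_gen (nc_var j) - (if i = j then 1 else 0) | i j. True} \<union>
    {(\<Sum>i\<in>UNIV. base_gen (nc_var i) * star_gen i) - 1}"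

definition leavitt_localization ::
    "('x :: finite, 'k :: ring_1) nc_series set \<Rightarrow> (('x, 'k) nc_series + 'x, 'k) nc_series set ring"
  where "leavitt_localization R =
    (let F = nc_poly_ring (Inl ` R \<union> range Inr) in F Quot (Idl\<^bsub>F\<^esub> (leavitt_relations R)))"

section \<open>Module type\<close>

text \<open>
  The library's locale for modules is restricted to commutative rings, but its record type is not;
  the fields \<open>mult\<close> and \<open>one\<close> of the record play no role for modules.
\<close>

definition free_left_module :: "('a, 'm) ring_scheme \<Rightarrow> nat \<Rightarrow> ('a, nat \<Rightarrow> 'a) module"
  where "free_left_module T p =
    \<lparr>carrier = {..<p} \<rightarrow>\<^sub>E carrier T,
     mult = undefined, one = undefined,
     zero = (\<lambda>i\<in>{..<p}. \<zero>\<^bsub>T\<^esub>),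
     add = (\<lambda>u v. \<lambda>i\<in>{..<p}. u i \<oplus>\<^bsub>T\<^esub> v i),
     smult = (\<lambda>t v. \<lambda>i\<in>{..<p}. t \<otimes>\<^bsub>T\<^esub> v i)\<rparr>"

definition left_modules_isomorphic ::
    "('a, 'm) ring_scheme \<Rightarrow> ('a, 'b) module \<Rightarrow> ('a, 'c) module \<Rightarrow> bool"
  where "left_modules_isomorphic T M N \<longleftrightarrow> (\<exists>\<phi>. bij_betw \<phi> (carrier M) (carrier N) \<and>
    (\<forall>u\<in>carrier M. \<forall>v\<in>carrier M. \<phi> (u \<oplus>\<^bsub>M\<^esub> v) = \<phi> u \<oplus>\<^bsub>N\<^esub> \<phi> v) \<and>
    (\<forall>t\<in>carrier T. \<forall>v\<in>carrier M. \<phi> (t \<odot>\<^bsub>M\<^esub> v) = t \<odot>\<^bsub>N\<^esub> \<phi> v))"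

definition free_ranks_isomorphic :: "('a, 'm) ring_scheme \<Rightarrow> nat \<Rightarrow> nat \<Rightarrow> bool"
  where "free_ranks_isomorphic T p q \<longleftrightarrow>
    left_modules_isomorphic T (free_left_module T p) (free_left_module T q)"

text \<open>
  The choice of left modules is immaterial: the free left modules of ranks \<open>p\<close> and \<open>q\<close> are
  isomorphic iff there are mutually inverse \<open>p \<times> q\<close> and \<open>q \<times> p\<close> matrices over \<open>T\<close>, and the same
  holds for right modules.
\<close>

definition has_module_type :: "('a, 'm) ring_scheme \<Rightarrow> nat \<Rightarrow> nat \<Rightarrow> bool"
  where "has_module_type T p q \<longleftrightarrow>
    ring T \<and> \<one>\<^bsub>T\<^esub> \<noteq> \<zero>\<^bsub>T\<^esub> \<and>
    1 \<le> p \<and> p < q \<and> free_ranks_isomorphic T p q \<and>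
    (\<forall>p' q'. 1 \<le> p' \<and> p' < q' \<and> free_ranks_isomorphic T p' q' \<longrightarrow> p \<le> p' \<and> q \<le> q')"

end

theory Submission
  imports Defs "HOL.Vector_Spaces" "HOL-Library.Poly_Mapping" "HOL-Library.Function_Algebras"
begin

text \<open>
  Let \<open>K\<close> be a residue field of the coefficient ring and \<open>n \<ge> 2\<close> the number of variables. A
  subalgebra \<open>R\<close> of the power series that contains the variables acts from the right on the space
  \<open>P\<close> of finite linear combinations of words over \<open>K\<close>, by \<open>w \<cdot> r = \<Sum> r(u) v\<close> over all factorizations \<open>w = u v\<close>, and \<open>x\<^sub>i\<^sup>*\<close>
  acts by putting the letter \<open>i\<close> in front of a word. Then \<open>x\<^sub>i\<^sup>* x\<^sub>j = \<delta>\<^sub>i\<^sub>j\<close> holds exactly, and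
  \<open>\<Sum> x\<^sub>i x\<^sub>i\<^sup>* = 1\<close> holds up to an operator with values in the words of bounded length. So mutually
  inverse \<open>p \<times> q\<close> and \<open>q \<times> p\<close> matrices over the Leavitt localization give operators \<open>P\<^sup>p \<rightarrow> P\<^sup>q\<close> and
  \<open>P\<^sup>q \<rightarrow> P\<^sup>p\<close> that are inverse to each other, and commute with deleting a last letter, up to bounded
  length. Counting dimensions gives \<open>p + n l = l + q n\<^sup>d\<close> for some \<open>l\<close> and \<open>d\<close>, hence \<open>n - 1\<close> divides
  \<open>q - p\<close>.
\<close>

section \<open>A residue field of a commutative ring\<close>

text \<open>The localization itself does not act on \<open>P\<close>: the operator of the sum of the
  \<open>x_i x_i^*\<close> kills the empty word. Only the free algebra on the generators acts, and
  what replaces a kernel is the two-sided ideal of elements whose operator has values in words of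
  bounded length; it contains the defining relations, hence the whole Leavitt ideal. As vector
  spaces all \<open>P^p\<close> with \<open>p \<ge> 1\<close> are isomorphic, so operators that are
  inverse up to bounded length do not restrict the ranks by themselves. The rigidity comes from the
  last letter: generators work at the front of a word, so deleting the last letter almost commutes
  with them, and this computes a dimension recursively, one empty word per coordinate plus
  \<open>n\<close> copies of the previous space. A power series may shorten words by any amount, so
  the operators only bound lengths from above. Hence the dimensions compared are those of preimages
  of bounded words, and their finiteness has to come from the inverse matrix. The residue field is
  there because dimensions need scalars in a field. Since \<open>p \<ge> 1\<close>, divisibility of
  \<open>q - p > 0\<close> by \<open>n - 1\<close> forces \<open>q \<ge> n\<close>, and
  \<open>(1, n)\<close> is attained by the row of the variables.\<close>

definition proper_ideal :: "'k :: comm_ring_1 set \<Rightarrow> bool"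
  where "proper_ideal I \<longleftrightarrow>
    0 \<in> I \<and> (\<forall>a\<in>I. \<forall>b\<in>I. a + b \<in> I) \<and> (\<forall>r. \<forall>a\<in>I. r * a \<in> I) \<and> 1 \<notin> I"

text \<open>Chosen once for each coefficient type, so that the residue field can be a type: a
  quotient type cannot depend on an ideal given as a variable.\<close>

definition max_ideal :: "'k :: comm_ring_1 set"
  where "max_ideal = (SOME M. proper_ideal M \<and> (\<forall>X. proper_ideal X \<and> M \<subseteq> X \<longrightarrow> X = M))"

lemma proper_ideal_Union_chain:
  assumes "C \<noteq> {}" and "subset.chain {I. proper_ideal I} C"
  shows "proper_ideal (\<Union>C :: 'k :: comm_ring_1 set)"
proof -
  have ideals: "proper_ideal I" if "I \<in> C" for I
    using assms(2) that by (auto simp: subset.chain_def)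
  have "a + b \<in> \<Union>C" if ab: "a \<in> \<Union>C" "b \<in> \<Union>C" for a b
  proof -
    obtain I J where IJ: "I \<in> C" "a \<in> I" "J \<in> C" "b \<in> J"
      using ab by blast
    then have "I \<subseteq> J \<or> J \<subseteq> I"
      using assms(2) unfolding subset_chain_def by blast
    then obtain K where "K \<in> C" "a \<in> K" "b \<in> K"
      using IJ by blast
    then show ?thesis
      using ideals[of K] by (auto simp: proper_ideal_def)
  qed
  with assms(1) ideals show ?thesis
    unfolding proper_ideal_def by blast
qed

lemma max_ideal:
  shows proper_max_ideal: "proper_ideal (max_ideal :: 'k :: comm_ring_1 set)"
    and max_ideal_maximal: "proper_ideal X \<Longrightarrow> max_ideal \<subseteq> X \<Longrightarrow> X = (max_ideal :: 'k set)"
proof -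
  have "proper_ideal {0 :: 'k}"
    by (simp add: proper_ideal_def)
  then have "{I :: 'k set. proper_ideal I} \<noteq> {}"
    by blast
  from subset_Zorn_nonempty[OF this]
  have "\<exists>M\<in>{I :: 'k set. proper_ideal I}. \<forall>X\<in>{I. proper_ideal I}. M \<subseteq> X \<longrightarrow> X = M"
    using proper_ideal_Union_chain by blast
  then have "\<exists>M :: 'k set. proper_ideal M \<and> (\<forall>X. proper_ideal X \<and> M \<subseteq> X \<longrightarrow> X = M)"
    by blast
  from someI_ex[OF this, folded max_ideal_def]
  show "proper_ideal (max_ideal :: 'k set)"
    and "proper_ideal X \<Longrightarrow> max_ideal \<subseteq> X \<Longrightarrow> X = (max_ideal :: 'k set)"
    by blast+
qed

lemma max_ideal_closed:
  shows max_ideal_0: "0 \<in> max_ideal"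
    and max_ideal_add: "a \<in> max_ideal \<Longrightarrow> b \<in> max_ideal \<Longrightarrow> a + b \<in> max_ideal"
    and max_ideal_mult: "a \<in> max_ideal \<Longrightarrow> r * a \<in> max_ideal"
    and one_notin_max_ideal: "1 \<notin> max_ideal"
  using proper_max_ideal unfolding proper_ideal_def by blast+

lemma max_ideal_uminus: "a \<in> max_ideal \<Longrightarrow> - a \<in> max_ideal"
  using max_ideal_mult[of a "- 1"] by simp

text \<open>The ideal \<open>?J\<close> generated by \<open>max_ideal\<close> and \<open>a\<close>
  is strictly larger than \<open>max_ideal\<close>, so it cannot be proper and must contain
  \<open>1\<close>.\<close>

lemma max_ideal_inverse:
  assumes "a \<notin> max_ideal"
  shows "\<exists>b. b * a - 1 \<in> max_ideal"
proof -
  let ?J = "{m + r * a | m r. m \<in> max_ideal}"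
  have "m \<in> ?J" if "m \<in> max_ideal" for m
    using that by (intro CollectI exI[of _ m] exI[of _ 0]) simp
  moreover have "a \<in> ?J"
    using max_ideal_0 by (intro CollectI exI[of _ 0] exI[of _ 1]) simp
  ultimately have "\<not> proper_ideal ?J"
    using max_ideal_maximal[of ?J] assms by blast
  moreover have "0 \<in> ?J"
    using max_ideal_0 by (intro CollectI exI[of _ 0]) simp
  moreover have "x + y \<in> ?J" if "x \<in> ?J" "y \<in> ?J" for x y
  proof -
    from that obtain m r m' r' where "m \<in> max_ideal" "m' \<in> max_ideal" "x = m + r * a" "y = m' + r' * a"
      by blast
    then have "x + y = (m + m') + (r + r') * a" "m + m' \<in> max_ideal"
      by (auto intro!: max_ideal_add simp: algebra_simps)
    then show ?thesis
      by blast
  qed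
  moreover have "s * x \<in> ?J" if "x \<in> ?J" for s x
  proof -
    from that obtain m r where "m \<in> max_ideal" "x = m + r * a"
      by blast
    then have "s * x = s * m + (s * r) * a" "s * m \<in> max_ideal"
      by (simp add: algebra_simps) (rule max_ideal_mult[OF \<open>m \<in> max_ideal\<close>])
    then show ?thesis
      by blast
  qed
  ultimately have "1 \<in> ?J"
    unfolding proper_ideal_def by blast
  then obtain m r where m: "m \<in> max_ideal" "1 = m + r * a"
    by blast
  then have "r * a - 1 = - m"
    by (simp add: algebra_simps)
  then show ?thesis
    using max_ideal_uminus[OF m(1)] by metis
qed

lemma max_ideal_cong_add:
  assumes "a - b \<in> max_ideal" "c - d \<in> max_ideal"
  shows "a + c - (b + d) \<in> max_ideal"
  using max_ideal_add[OF assms] by (simp add: algebra_simps)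

lemma max_ideal_cong_uminus: "a - b \<in> max_ideal \<Longrightarrow> - a - - b \<in> max_ideal"
  using max_ideal_uminus[of "a - b"] by simp

lemma max_ideal_cong_mult:
  assumes "a - b \<in> max_ideal" "c - d \<in> max_ideal"
  shows "a * c - b * d \<in> max_ideal"
proof -
  have "c * (a - b) + b * (c - d) \<in> max_ideal"
    by (intro max_ideal_add max_ideal_mult assms)
  moreover have "c * (a - b) + b * (c - d) = a * c - b * d"
    by (simp add: algebra_simps)
  ultimately show ?thesis
    by simp
qed

quotient_type (overloaded) 'k resfield = "'k :: comm_ring_1" / "\<lambda>x y. x - y \<in> max_ideal"
  morphisms rep_res res
proof (rule equivpI)
  show "reflp (\<lambda>x y :: 'k. x - y \<in> max_ideal)"
    by (simp add: reflp_def max_ideal_0)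
  show "symp (\<lambda>x y :: 'k. x - y \<in> max_ideal)"
  proof (rule sympI)
    fix x y :: 'k
    assume "x - y \<in> max_ideal"
    from max_ideal_uminus[OF this] show "y - x \<in> max_ideal"
      by simp
  qed
  show "transp (\<lambda>x y :: 'k. x - y \<in> max_ideal)"
  proof (rule transpI)
    fix x y z :: 'k
    assume "x - y \<in> max_ideal" "y - z \<in> max_ideal"
    from max_ideal_add[OF this] show "x - z \<in> max_ideal"
      by simp
  qed
qed

instantiation resfield :: (comm_ring_1) field
begin

lift_definition zero_resfield :: "'a resfield" is 0 .
lift_definition one_resfield :: "'a resfield" is 1 .

lift_definition plus_resfield :: "'a resfield \<Rightarrow> 'a resfield \<Rightarrow> 'a resfield" is "(+)"
  by (rule max_ideal_cong_add)

lift_definition uminus_resfield :: "'a resfield \<Rightarrow> 'a resfield" is uminus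
  by (rule max_ideal_cong_uminus)

lift_definition times_resfield :: "'a resfield \<Rightarrow> 'a resfield \<Rightarrow> 'a resfield" is "(*)"
  by (rule max_ideal_cong_mult)

definition minus_resfield :: "'a resfield \<Rightarrow> 'a resfield \<Rightarrow> 'a resfield"
  where "x - y = x + - (y :: 'a resfield)"

definition inverse_resfield :: "'a resfield \<Rightarrow> 'a resfield"
  where "inverse x = (if x = 0 then 0 else SOME y. y * x = (1 :: 'a resfield))"

definition divide_resfield :: "'a resfield \<Rightarrow> 'a resfield \<Rightarrow> 'a resfield"
  where "x div y = x * inverse (y :: 'a resfield)"

instance
proof
  fix a b c :: "'a resfield"
  show "a + b + c = a + (b + c)"
    by transfer (simp add: max_ideal_0 add.assoc)
  show "a + b = b + a"
    by transfer (simp add: max_ideal_0 add.commute)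
  show "0 + a = a"
    by transfer (simp add: max_ideal_0)
  show "- a + a = 0"
    by transfer (simp add: max_ideal_0)
  show "a - b = a + - b"
    by (simp add: minus_resfield_def)
  show "a * b * c = a * (b * c)"
    by transfer (simp add: max_ideal_0 mult.assoc)
  show "a * b = b * a"
    by transfer (simp add: max_ideal_0 mult.commute)
  show "1 * a = a"
    by transfer (simp add: max_ideal_0)
  show "(a + b) * c = a * c + b * c"
    by transfer (simp add: max_ideal_0 algebra_simps)
  show "(0 :: 'a resfield) \<noteq> 1"
  proof transfer
    show "\<not> (0 - 1 :: 'a) \<in> max_ideal"
      using max_ideal_uminus[of "- 1 :: 'a"] one_notin_max_ideal by auto
  qed
  show "a div b = a * inverse b"
    by (simp add: divide_resfield_def)
  show "inverse (0 :: 'a resfield) = 0"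
    by (simp add: inverse_resfield_def)
  have "\<exists>y. y * a = 1" if "a \<noteq> 0"
    using that
  proof transfer
    fix a :: 'a
    assume "a - 0 \<notin> max_ideal"
    then show "\<exists>y. y * a - 1 \<in> max_ideal"
      using max_ideal_inverse by simp
  qed
  then show "inverse a * a = 1" if "a \<noteq> 0"
    using someI_ex[of "\<lambda>y. y * a = 1"] that by (simp add: inverse_resfield_def)
qed

end

lemma res_add [simp]: "res (a + b) = res a + res b"
  by (simp add: plus_resfield.abs_eq)
lemma res_mult [simp]: "res (a * b) = res a * res b"
  by (simp add: times_resfield.abs_eq)
lemma res_0 [simp]: "res 0 = 0"
  by (simp add: zero_resfield_def)
lemma res_1 [simp]: "res 1 = 1"
  by (simp add: one_resfield_def)

section \<open>Rank and nullity with finite-dimensional kernel and image\<close>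

context vector_space
begin

text \<open>For an infinite-dimensional set \<open>dim\<close> has the meaningless value
  \<open>0\<close>, so every dimension count below has to carry this condition along.\<close>

definition fin_dim :: "'b set \<Rightarrow> bool"
  where "fin_dim S \<longleftrightarrow> (\<exists>B. finite B \<and> S \<subseteq> span B)"

lemma fin_dim_subset: "fin_dim T \<Longrightarrow> S \<subseteq> T \<Longrightarrow> fin_dim S"
  unfolding fin_dim_def by blast

lemma fin_dim_basis:
  assumes "fin_dim S"
  obtains B where "finite B" "B \<subseteq> S" "independent B" "S \<subseteq> span B" "card B = dim S"
proof -
  obtain C where C: "finite C" "S \<subseteq> span C"
    using assms unfolding fin_dim_def by blast
  obtain B where B: "B \<subseteq> S" "independent B" "S \<subseteq> span B" "card B = dim S"
    using basis_exists by blast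
  have "finite B"
    using independent_span_bound[OF C(1) B(2)] B(1) C(2) by blast
  with B that show thesis by blast
qed

end

context vector_space_pair
begin

text \<open>The ambient spaces are infinite-dimensional and finiteness of \<open>U\<close> is part
  of the conclusion. A basis of the kernel together with lifts \<open>g\<close> of a basis of the
  image is a basis of \<open>U\<close>.\<close>

lemma rank_nullity_on:
  assumes f: "Vector_Spaces.linear s1 s2 f" and U: "vs1.subspace U"
    and ker: "vs1.fin_dim {u \<in> U. f u = 0}" and im: "vs2.fin_dim (f ` U)"
  shows "vs1.fin_dim U" and "vs1.dim U = vs1.dim {u \<in> U. f u = 0} + vs2.dim (f ` U)"
proof -
  interpret f: Vector_Spaces.linear s1 s2 f by (fact f)
  let ?K = "{u \<in> U. f u = 0}"
  obtain B where B: "finite B" "B \<subseteq> ?K" "vs1.independent B" "?K \<subseteq> vs1.span B" "card B = vs1.dim ?K"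
    using vs1.fin_dim_basis[OF ker] by blast
  obtain C where C: "finite C" "C \<subseteq> f ` U" "vs2.independent C" "f ` U \<subseteq> vs2.span C"
    "card C = vs2.dim (f ` U)"
    using vs2.fin_dim_basis[OF im] by blast
  have "\<forall>c\<in>C. \<exists>u. u \<in> U \<and> f u = c"
    using C(2) by blast
  from bchoice[OF this] obtain g where g: "\<And>c. c \<in> C \<Longrightarrow> g c \<in> U \<and> f (g c) = c"
    by blast
  have inj: "inj_on g C"
    by (rule inj_on_inverseI[where g = f]) (simp add: g)
  have spanB: "f u = 0" if "u \<in> vs1.span B" for u
    using that
  proof (induction rule: vs1.span_induct_alt)
    case base
    show ?case by (rule f.zero)
  next
    case (step c x y)
    then show ?case using B(2) by (auto simp: f.add f.scale)
  qed
  have disj: "B \<inter> g ` C = {}"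
  proof -
    have "c \<noteq> 0" if "c \<in> C" for c
      using C(3) that vs2.dependent_zero by blast
    moreover have "c = 0" if "c \<in> C" "g c \<in> B" for c
      using B(2) g[OF that(1)] that(2) by auto
    ultimately show ?thesis
      by blast
  qed
  have fin: "finite (B \<union> g ` C)"
    using B(1) C(1) by blast
  have span: "U \<subseteq> vs1.span (B \<union> g ` C)"
  proof
    fix u assume u: "u \<in> U"
    then have "f u \<in> vs2.span C"
      using C(4) by blast
    then obtain a where a: "f u = (\<Sum>c\<in>C. s2 (a c) c)"
      using vs2.span_finite[OF C(1)] by auto
    \<comment> \<open>The lift of \<open>f u\<close> along \<open>g\<close>; it differs from
      \<open>u\<close> by an element of the kernel.\<close>
    define u' where "u' = (\<Sum>c\<in>C. s1 (a c) (g c))"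
    have "u' \<in> vs1.span (g ` C)"
      unfolding u'_def by (intro vs1.span_sum vs1.span_scale vs1.span_base) blast
    then have u'S: "u' \<in> vs1.span (B \<union> g ` C)"
      using vs1.span_mono[of "g ` C" "B \<union> g ` C"] by blast
    have u'U: "u' \<in> U"
      unfolding u'_def using g by (intro vs1.subspace_sum[OF U] vs1.subspace_scale[OF U]) blast
    have "f u' = f u"
      unfolding u'_def a f.sum f.scale using g by (intro sum.cong) auto
    then have "u - u' \<in> ?K"
      using vs1.subspace_diff[OF U u u'U] by (simp add: f.diff)
    then have "u - u' \<in> vs1.span (B \<union> g ` C)"
      using B(4) vs1.span_mono[of B "B \<union> g ` C"] by blast
    from vs1.span_add[OF this u'S] show "u \<in> vs1.span (B \<union> g ` C)"
      by simp
  qed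
  have "vs1.independent (B \<union> g ` C)"
  proof (rule vs1.independent_if_scalars_zero[OF fin])
    fix a x
    assume sum0: "(\<Sum>x\<in>B \<union> g ` C. s1 (a x) x) = 0" and x: "x \<in> B \<union> g ` C"
    have split: "(\<Sum>x\<in>B \<union> g ` C. s1 (a x) x) = (\<Sum>x\<in>B. s1 (a x) x) + (\<Sum>c\<in>C. s1 (a (g c)) (g c))"
      using sum.union_disjoint[OF B(1) finite_imageI[OF C(1)] disj]
      by (simp add: sum.reindex[OF inj] o_def)
    have "f (\<Sum>x\<in>B. s1 (a x) x) = 0"
      by (intro spanB vs1.span_sum vs1.span_scale vs1.span_base)
    \<comment> \<open>Applying \<open>f\<close> removes the kernel part of the relation and leaves
      one between the independent vectors of \<open>C\<close>.\<close>
    then have "0 = f (\<Sum>c\<in>C. s1 (a (g c)) (g c))"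
      using arg_cong[OF sum0[unfolded split], of f] by (simp add: f.add f.zero)
    also have "\<dots> = (\<Sum>c\<in>C. s2 (a (g c)) c)"
      unfolding f.sum f.scale using g by (intro sum.cong) auto
    finally have aC: "a (g c) = 0" if "c \<in> C" for c
      using vs2.independentD[OF C(3) C(1) order_refl, of "\<lambda>c. a (g c)" c] that by simp
    then have "(\<Sum>x\<in>B. s1 (a x) x) = 0"
      using sum0 unfolding split by simp
    then have "a b = 0" if "b \<in> B" for b
      using vs1.independentD[OF B(3) B(1) order_refl, of a b] that by simp
    with aC x show "a x = 0"
      by blast
  qed
  moreover have "B \<union> g ` C \<subseteq> U"
    using B(2) g by blast
  moreover have "card (B \<union> g ` C) = card B + card C"
    using card_Un_disjoint[OF B(1) finite_imageI[OF C(1)] disj] card_image[OF inj] by simp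
  ultimately show "vs1.dim U = vs1.dim ?K + vs2.dim (f ` U)"
    using vs1.basis_card_eq_dim[OF _ span] B(5) C(5) by metis
  show "vs1.fin_dim U"
    unfolding vs1.fin_dim_def using fin span by blast
qed

end

section \<open>An index formula for operators on words\<close>

abbreviation lookup :: "('a \<Rightarrow>\<^sub>0 'f :: zero) \<Rightarrow> 'a \<Rightarrow> 'f"
  where "lookup \<equiv> Poly_Mapping.lookup"

abbreviation keys :: "('a \<Rightarrow>\<^sub>0 'f :: zero) \<Rightarrow> 'a set"
  where "keys \<equiv> Poly_Mapping.keys"

definition pscale :: "'f :: field \<Rightarrow> ('a \<Rightarrow>\<^sub>0 'f) \<Rightarrow> ('a \<Rightarrow>\<^sub>0 'f)"
  where "pscale c v = Poly_Mapping.map ((*) c) v"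

lemma lookup_pscale [simp]: "lookup (pscale c v) w = c * lookup v w"
  unfolding pscale_def by (simp add: Poly_Mapping.map.rep_eq when_def)

definition vscale :: "'f :: field \<Rightarrow> (nat \<Rightarrow> 'a \<Rightarrow>\<^sub>0 'f) \<Rightarrow> nat \<Rightarrow> 'a \<Rightarrow>\<^sub>0 'f"
  where "vscale c u = (\<lambda>i. pscale c (u i))"

lemma lookup_vscale [simp]: "lookup (vscale c u i) w = c * lookup (u i) w"
  by (simp add: vscale_def)

lemma vec_eqI: "(\<And>i w. lookup (u i) w = lookup (v i) w) \<Longrightarrow> u = (v :: nat \<Rightarrow> 'a \<Rightarrow>\<^sub>0 'f :: zero)"
  by (rule ext, rule poly_mapping_eqI)

interpretation pvec: vector_space "pscale :: 'f :: field \<Rightarrow> ('a \<Rightarrow>\<^sub>0 'f) \<Rightarrow> _"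
  by standard (auto intro!: poly_mapping_eqI simp: lookup_add algebra_simps)

interpretation vec: vector_space "vscale :: 'f :: field \<Rightarrow> (nat \<Rightarrow> 'a \<Rightarrow>\<^sub>0 'f) \<Rightarrow> _"
  by standard (auto intro!: vec_eqI simp: lookup_add algebra_simps)

interpretation vec_pair: vector_space_pair
  "vscale :: 'f :: field \<Rightarrow> (nat \<Rightarrow> 'a \<Rightarrow>\<^sub>0 'f) \<Rightarrow> _" "vscale :: 'f :: field \<Rightarrow> (nat \<Rightarrow> 'a \<Rightarrow>\<^sub>0 'f) \<Rightarrow> _"
  ..

text \<open>The tuples in \<open>P^p\<close> whose entries use only words from \<open>L\<close>.
  Tuples of all lengths share one type, being zero from index \<open>p\<close> on, so that maps
  between different ranks are endomaps of a single vector space.\<close>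

definition vecs :: "nat \<Rightarrow> 'a set \<Rightarrow> (nat \<Rightarrow> 'a \<Rightarrow>\<^sub>0 'f :: field) set"
  where "vecs p L = {u. (\<forall>i. keys (u i) \<subseteq> L) \<and> (\<forall>i\<ge>p. u i = 0)}"

lemma vecs_mono: "L \<subseteq> M \<Longrightarrow> vecs p L \<subseteq> vecs p M"
  unfolding vecs_def by blast

lemma vecs_iff: "u \<in> vecs p L \<longleftrightarrow> (\<forall>i w. lookup (u i) w \<noteq> 0 \<longrightarrow> i < p \<and> w \<in> L)"
proof
  assume "u \<in> vecs p L"
  then have "keys (u i) \<subseteq> L" "i \<ge> p \<longrightarrow> u i = 0" for i
    by (auto simp: vecs_def)
  then show "\<forall>i w. lookup (u i) w \<noteq> 0 \<longrightarrow> i < p \<and> w \<in> L"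
    by (metis in_keys_iff lookup_zero not_le subsetD)
next
  assume *: "\<forall>i w. lookup (u i) w \<noteq> 0 \<longrightarrow> i < p \<and> w \<in> L"
  then have "u i = 0" if "i \<ge> p" for i
    using that by (intro poly_mapping_eqI) (auto simp: not_le[symmetric])
  with * show "u \<in> vecs p L"
    by (auto simp: vecs_def in_keys_iff)
qed

lemma subspace_vecs: "vec.subspace (vecs p L :: (nat \<Rightarrow> 'a \<Rightarrow>\<^sub>0 'f :: field) set)"
proof (rule vec.subspaceI)
  fix x y :: "nat \<Rightarrow> 'a \<Rightarrow>\<^sub>0 'f" and c :: 'f
  assume x: "x \<in> vecs p L"
  show "vscale c x \<in> vecs p L"
    using x by (auto simp: vecs_iff)
  assume y: "y \<in> vecs p L"
  show "x + y \<in> vecs p L"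
    unfolding vecs_iff
  proof (intro allI impI)
    fix i w
    assume "lookup ((x + y) i) w \<noteq> 0"
    then have "lookup (x i) w \<noteq> 0 \<or> lookup (y i) w \<noteq> 0"
      by (auto simp: lookup_add)
    with x y show "i < p \<and> w \<in> L"
      unfolding vecs_iff by blast
  qed
qed (simp add: vecs_iff)

definition unit_vec :: "nat \<times> 'a \<Rightarrow> nat \<Rightarrow> 'a \<Rightarrow>\<^sub>0 'f :: field"
  where "unit_vec = (\<lambda>(i, w) j. if j = i then Poly_Mapping.single w 1 else 0)"

lemma lookup_unit_vec: "lookup (unit_vec x j) w = (if x = (j, w) then 1 else 0)"
  by (cases x) (simp add: unit_vec_def lookup_single when_def)

lemma lookup_sum_vec: "lookup ((\<Sum>x\<in>S. g x) i) w = (\<Sum>x\<in>S. lookup (g x i) w)"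
  by (induction S rule: infinite_finite_induct) (simp_all add: lookup_add)

lemma lookup_sum_unit_vec:
  assumes "finite S"
  shows "lookup ((\<Sum>x\<in>S. vscale (a x) (unit_vec x)) i) w = (if (i, w) \<in> S then a (i, w) else 0)"
proof -
  have "lookup ((\<Sum>x\<in>S. vscale (a x) (unit_vec x)) i) w = (\<Sum>x\<in>S. if x = (i, w) then a x else 0)"
    unfolding lookup_sum_vec by (intro sum.cong) (simp_all add: lookup_unit_vec)
  then show ?thesis
    using assms by simp
qed

lemma vecs_finite_dim:
  assumes "finite L"
  shows fin_dim_vecs: "vec.fin_dim (vecs p L :: (nat \<Rightarrow> 'a \<Rightarrow>\<^sub>0 'f :: field) set)"
    and dim_vecs: "vec.dim (vecs p L :: (nat \<Rightarrow> 'a \<Rightarrow>\<^sub>0 'f :: field) set) = p * card L"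
proof -
  let ?S = "{..<p} \<times> L"
  let ?B = "unit_vec ` ?S :: (nat \<Rightarrow> 'a \<Rightarrow>\<^sub>0 'f) set"
  have fin: "finite ?S"
    using assms by simp
  have inj: "inj_on (unit_vec :: _ \<Rightarrow> nat \<Rightarrow> 'a \<Rightarrow>\<^sub>0 'f) ?S"
  proof (rule inj_onI)
    fix x y :: "nat \<times> 'a"
    assume "unit_vec x = (unit_vec y :: nat \<Rightarrow> 'a \<Rightarrow>\<^sub>0 'f)"
    then have "lookup (unit_vec x (fst y) :: 'a \<Rightarrow>\<^sub>0 'f) (snd y) = 1"
      by (simp add: lookup_unit_vec)
    then show "x = y"
      by (simp add: lookup_unit_vec split: if_splits)
  qed
  have span: "vecs p L \<subseteq> vec.span ?B"
  proof
    fix u :: "nat \<Rightarrow> 'a \<Rightarrow>\<^sub>0 'f"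
    assume u: "u \<in> vecs p L"
    have "u = (\<Sum>x\<in>?S. vscale (lookup (u (fst x)) (snd x)) (unit_vec x))"
    proof (rule vec_eqI)
      fix i w
      show "lookup (u i) w = lookup ((\<Sum>x\<in>?S. vscale (lookup (u (fst x)) (snd x)) (unit_vec x)) i) w"
        unfolding lookup_sum_unit_vec[OF fin] using u by (auto simp: vecs_iff)
    qed
    also have "\<dots> \<in> vec.span ?B"
      by (intro vec.span_sum vec.span_scale vec.span_base) blast
    finally show "u \<in> vec.span ?B" .
  qed
  have ind: "vec.independent ?B"
  proof (rule vec.independent_if_scalars_zero)
    show "finite ?B"
      using fin by blast
    fix a and y :: "nat \<Rightarrow> 'a \<Rightarrow>\<^sub>0 'f"
    assume sum: "(\<Sum>x\<in>?B. vscale (a x) x) = 0" and y: "y \<in> ?B"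
    from y obtain i w where iw: "(i, w) \<in> ?S" "y = unit_vec (i, w)"
      by blast
    have "(\<Sum>x\<in>?S. vscale (a (unit_vec x)) (unit_vec x)) = 0"
      using sum by (simp add: sum.reindex[OF inj] o_def)
    then have "lookup ((\<Sum>x\<in>?S. vscale (a (unit_vec x)) (unit_vec x)) i) w = 0"
      by simp
    then show "a y = 0"
      unfolding lookup_sum_unit_vec[OF fin] using iw by simp
  qed
  have sub: "?B \<subseteq> vecs p L"
    by (auto simp: vecs_iff lookup_unit_vec split: if_splits)
  show "vec.fin_dim (vecs p L :: (nat \<Rightarrow> 'a \<Rightarrow>\<^sub>0 'f) set)"
    unfolding vec.fin_dim_def using fin span by blast
  show "vec.dim (vecs p L :: (nat \<Rightarrow> 'a \<Rightarrow>\<^sub>0 'f) set) = p * card L"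
    using vec.basis_card_eq_dim[OF sub span ind] card_image[OF inj] by (simp add: card_cartesian_product)
qed

definition deriv_last :: "'x \<Rightarrow> ('x list \<Rightarrow>\<^sub>0 'f) \<Rightarrow> ('x list \<Rightarrow>\<^sub>0 'f :: zero)"
  where "deriv_last j v = Poly_Mapping.map_key (\<lambda>w. w @ [j]) v"

lemma lookup_deriv_last [simp]: "lookup (deriv_last j v) w = lookup v (w @ [j])"
  unfolding deriv_last_def by (subst map_key.rep_eq) (auto simp: inj_def)

text \<open>A right inverse of \<open>deriv_last j\<close> that is killed by
  \<open>deriv_last i\<close> for every other letter \<open>i\<close>; it yields the surjectivity in
  the dimension count.\<close>

definition append_last :: "'x \<Rightarrow> ('x list \<Rightarrow>\<^sub>0 'f) \<Rightarrow> ('x list \<Rightarrow>\<^sub>0 'f :: comm_monoid_add)"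
  where "append_last j v = (\<Sum>w\<in>keys v. Poly_Mapping.single (w @ [j]) (lookup v w))"

lemma deriv_last_append_last: "deriv_last i (append_last j v) = (if i = j then v else 0)"
proof (rule poly_mapping_eqI)
  fix w
  have "lookup (deriv_last i (append_last j v)) w
      = (\<Sum>w'\<in>keys v. if w' = w \<and> i = j then lookup v w' else 0)"
    unfolding append_last_def lookup_deriv_last lookup_sum lookup_single
    by (intro sum.cong) (auto simp: when_def)
  then show "lookup (deriv_last i (append_last j v)) w = lookup (if i = j then v else 0) w"
    by (auto simp: in_keys_iff)
qed

abbreviation vderiv :: "'x \<Rightarrow> (nat \<Rightarrow> 'x list \<Rightarrow>\<^sub>0 'f) \<Rightarrow> nat \<Rightarrow> 'x list \<Rightarrow>\<^sub>0 'f :: field"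
  where "vderiv j u \<equiv> (\<lambda>i. deriv_last j (u i))"

lemma linear_vderiv: "Vector_Spaces.linear vscale vscale (vderiv j)"
  using vec.vector_space_axioms by (auto intro!: vec_eqI simp: linear_iff lookup_add)

text \<open>A nonempty word in the support of \<open>u\<close> is \<open>w @ [j]\<close>, and
  \<open>vderiv j\<close> sees it as \<open>w\<close>. The empty word is invisible to all
  \<open>vderiv j\<close> but satisfies the bound because it is \<open>Suc d\<close>.\<close>

lemma vecs_vderiv_iff:
  "u \<in> vecs p {w. length w < Suc d} \<longleftrightarrow> u \<in> vecs p UNIV \<and> (\<forall>j. vderiv j u \<in> vecs p {w. length w < d})"
proof
  assume *: "u \<in> vecs p UNIV \<and> (\<forall>j. vderiv j u \<in> vecs p {w. length w < d})"
  have "length w < Suc d" if "lookup (u i) w \<noteq> 0" for i w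
    using that * by (cases w rule: rev_cases) (auto simp: vecs_iff)
  with * show "u \<in> vecs p {w. length w < Suc d}"
    by (auto simp: vecs_iff)
qed (fastforce simp: vecs_iff)

definition component :: "'a set \<Rightarrow> ('a \<Rightarrow>\<^sub>0 'f) \<Rightarrow> 'a \<Rightarrow>\<^sub>0 'f :: comm_monoid_add"
  where "component L v = (\<Sum>w\<in>keys v \<inter> L. Poly_Mapping.single w (lookup v w))"

lemma lookup_component [simp]: "lookup (component L v) w = (if w \<in> L then lookup v w else 0)"
proof -
  have "lookup (component L v) w = (\<Sum>w'\<in>keys v \<inter> L. if w' = w then lookup v w' else 0)"
    unfolding component_def lookup_sum lookup_single by (intro sum.cong) (auto simp: when_def)
  then show ?thesis
    by (auto simp: in_keys_iff)
qed

abbreviation vcomponent :: "'a set \<Rightarrow> (nat \<Rightarrow> 'a \<Rightarrow>\<^sub>0 'f) \<Rightarrow> nat \<Rightarrow> 'a \<Rightarrow>\<^sub>0 'f :: field"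
  where "vcomponent L u \<equiv> (\<lambda>i. component L (u i))"

lemma linear_vcomponent: "Vector_Spaces.linear vscale vscale (vcomponent L)"
  using vec.vector_space_axioms by (auto intro!: vec_eqI simp: linear_iff lookup_add)

lemma finite_length_less: "finite {w :: 'x :: finite list. length w < d}"
  using finite_lists_length_le[of "UNIV :: 'x set" d] by (rule rev_finite_subset) auto

lemma card_length_eq: "card {w :: 'x :: finite list. length w = d} = CARD('x) ^ d"
  using card_lists_length_eq[of "UNIV :: 'x set" d] by simp

text \<open>A tuple is determined by its \<open>p\<close> coefficients at the empty word and by its
  derivatives \<open>vderiv j u\<close>, one for each letter, which can be prescribed independently
  in \<open>S\<close>.\<close>

lemma dim_vderiv_preimage:
  fixes S :: "(nat \<Rightarrow> 'x :: finite list \<Rightarrow>\<^sub>0 'f :: field) set"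
  assumes S: "vec.subspace S" "vec.fin_dim S" and p: "S \<subseteq> vecs p UNIV"
  shows "vec.dim {u \<in> vecs p UNIV. \<forall>j. vderiv j u \<in> S} = p + CARD('x) * vec.dim S"
proof -
  define F where "F J = {u \<in> vecs p UNIV. \<forall>j. vderiv j u \<in> (if j \<in> J then S else {0})}" for J
  have S0: "0 \<in> S"
    using S(1) by (rule vec.subspace_0)
  interpret D: Vector_Spaces.linear vscale vscale "vderiv j" for j
    by (rule linear_vderiv)
  have sub: "vec.subspace (F J)" for J
  proof -
    have "vec.subspace (if j \<in> J then S else {0})" for j
      using S(1) by simp
    then have "vec.subspace {u. vderiv j u \<in> (if j \<in> J then S else {0})}" for j
      by (rule D.subspace_vimage[unfolded vimage_def])
    then show ?thesis
      using subspace_vecs[of p "UNIV :: 'x list set"] unfolding F_def vec.subspace_def by auto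
  qed
  have "vec.fin_dim (F J) \<and> vec.dim (F J) = p + card J * vec.dim S" if "finite J" for J
    using that
  proof (induction J)
    case empty
    have "F {} = vecs p {[]}"
    proof -
      have "w = []" if "\<forall>j. vderiv j u = 0" "lookup (u i) w \<noteq> 0" for u :: "nat \<Rightarrow> 'x list \<Rightarrow>\<^sub>0 'f" and i w
      proof (cases w rule: rev_cases)
        case (snoc w' j)
        have "lookup (vderiv j u i) w' = 0"
          using fun_cong[OF spec[OF that(1), of j], of i] by simp
        with that(2) snoc show ?thesis
          by simp
      qed
      moreover have "vderiv j u = 0" if "u \<in> vecs p {[]}" for u :: "nat \<Rightarrow> 'x list \<Rightarrow>\<^sub>0 'f" and j
        using that by (intro vec_eqI) (auto simp: vecs_iff)
      ultimately show ?thesis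
        by (auto simp: F_def vecs_iff)
    qed
    then show ?case
      using fin_dim_vecs[of "{[] :: 'x list}" p, where ?'f = 'f]
        dim_vecs[of "{[] :: 'x list}" p, where ?'f = 'f] by simp
  next
    case (insert j J)
    have ker: "{u \<in> F (insert j J). vderiv j u = 0} = F J"
      using insert.hyps(2) S0 unfolding F_def by (auto split: if_splits)
    have im: "vderiv j ` F (insert j J) = S"
    proof
      show "vderiv j ` F (insert j J) \<subseteq> S"
        unfolding F_def by (auto split: if_splits)
      show "S \<subseteq> vderiv j ` F (insert j J)"
      proof
        fix s assume s: "s \<in> S"
        \<comment> \<open>All its derivatives vanish except the one by \<open>j\<close>, so it lies
          in \<open>F (insert j J)\<close> whatever \<open>J\<close> is.\<close>
        let ?u = "\<lambda>i. append_last j (s i)"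
        have "vderiv i ?u = (if i = j then s else 0)" for i
          by (auto simp: deriv_last_append_last)
        moreover have "?u \<in> vecs p UNIV"
          using s p unfolding vecs_def by (auto simp: append_last_def)
        ultimately show "s \<in> vderiv j ` F (insert j J)"
          using s S0 unfolding F_def by (intro image_eqI[of _ _ ?u]) auto
      qed
    qed
    show ?case
      using vec_pair.rank_nullity_on[OF linear_vderiv sub[of "insert j J"], of j]
        insert S(2) unfolding ker im by simp
  qed
  from this[of UNIV] show ?thesis
    unfolding F_def by simp
qed

text \<open>
  Both sides are the dimension of the space of vectors that \<open>A\<close> maps to combinations of words of length
  at most \<open>d\<close>, and \<open>l\<close> is the dimension of the space obtained with words of length less than \<open>d\<close>.
\<close>

theorem index_formula:
  fixes A B :: "(nat \<Rightarrow> 'x :: finite list \<Rightarrow>\<^sub>0 'f :: field) \<Rightarrow> (nat \<Rightarrow> 'x list \<Rightarrow>\<^sub>0 'f)"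
  assumes A: "Vector_Spaces.linear vscale vscale A"
    and Aq: "\<And>u. A u \<in> vecs q UNIV" and Bp: "\<And>u. B u \<in> vecs p UNIV"
    and AB: "\<And>u. u \<in> vecs q UNIV \<Longrightarrow> A (B u) - u \<in> vecs q {w. length w < d}"
    and BA: "\<And>u. u \<in> vecs p UNIV \<Longrightarrow> B (A u) - u \<in> vecs p {w. length w < d}"
    and B: "\<And>u. u \<in> vecs q {w. length w < d} \<Longrightarrow> B u \<in> vecs p {w. length w < e}"
    and comm: "\<And>j u. vderiv j (A u) - A (vderiv j u) \<in> vecs q {w. length w < d}"
  shows "\<exists>l. p + CARD('x) * l = l + q * CARD('x) ^ d"
proof -
  define P where "P m = {u \<in> vecs p UNIV. A u \<in> vecs q {w. length w < m}}" for m
  let ?H = "{w :: 'x list. length w = d}"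
  interpret A: Vector_Spaces.linear vscale vscale A
    by (rule A)
  have sub: "vec.subspace (P m)" for m
    using subspace_vecs[of p "UNIV :: 'x list set", where ?'f = 'f]
      subspace_vecs[of q "{w :: 'x list. length w < m}", where ?'f = 'f]
    unfolding P_def vec.subspace_def by (auto simp: A.add A.scale A.zero)
  \<comment> \<open>That \<open>A u\<close> has short words says nothing directly about the words of
    \<open>u\<close>, since \<open>A\<close> may shorten them arbitrarily. The bound comes from
    writing \<open>u\<close> as \<open>B (A u)\<close> minus the error
    \<open>B (A u) - u\<close>.\<close>
  have "P d \<subseteq> vecs p {w. length w < max d e}"
  proof
    fix u assume u: "u \<in> P d"
    then have "B (A u) \<in> vecs p {w. length w < e}" "B (A u) - u \<in> vecs p {w. length w < d}"
      using B BA by (auto simp: P_def)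
    then have "B (A u) \<in> vecs p {w. length w < max d e}" "B (A u) - u \<in> vecs p {w. length w < max d e}"
      by (auto simp: vecs_iff less_max_iff_disj)
    from vec.subspace_diff[OF subspace_vecs this] show "u \<in> vecs p {w. length w < max d e}"
      by simp
  qed
  then have fin: "vec.fin_dim (P d)"
    using vec.fin_dim_subset fin_dim_vecs[OF finite_length_less] by blast
  \<comment> \<open>The commutator of \<open>A\<close> with \<open>vderiv j\<close> takes values in
    words of length less than \<open>d\<close>, exactly the bound to be tested after one
    differentiation, so the two maps may be exchanged in the condition.\<close>
  have P_Suc: "P (Suc d) = {u \<in> vecs p UNIV. \<forall>j. vderiv j u \<in> P d}"
  proof -
    have "vderiv j (A u) \<in> vecs q {w. length w < d} \<longleftrightarrow> A (vderiv j u) \<in> vecs q {w. length w < d}" for u j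
    proof
      assume "vderiv j (A u) \<in> vecs q {w. length w < d}"
      from vec.subspace_diff[OF subspace_vecs this comm[of j u]]
      show "A (vderiv j u) \<in> vecs q {w. length w < d}" by simp
    next
      assume "A (vderiv j u) \<in> vecs q {w. length w < d}"
      from vec.subspace_add[OF subspace_vecs comm[of j u] this]
      show "vderiv j (A u) \<in> vecs q {w. length w < d}" by simp
    qed
    moreover have "vderiv j u \<in> vecs p UNIV" if "u \<in> vecs p UNIV" for u :: "nat \<Rightarrow> 'x list \<Rightarrow>\<^sub>0 'f" and j
      using that by (auto simp: vecs_iff)
    ultimately show ?thesis
      using Aq unfolding P_def vecs_vderiv_iff[of _ q] by auto
  qed
  have dim1: "vec.dim (P (Suc d)) = p + CARD('x) * vec.dim (P d)"
    unfolding P_Suc by (rule dim_vderiv_preimage[OF sub fin]) (auto simp: P_def)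
  \<comment> \<open>The part of \<open>A u\<close> in length exactly \<open>d\<close>: on
    \<open>P (Suc d)\<close> this is the top length, so its vanishing characterizes
    \<open>P d\<close>.\<close>
  define f where "f = (\<lambda>u. vcomponent ?H (A u))"
  have f: "Vector_Spaces.linear vscale vscale f"
    using Vector_Spaces.linear_compose[OF A linear_vcomponent] by (simp add: f_def o_def)
  have ker: "{u \<in> P (Suc d). f u = 0} = P d"
  proof -
    have "f u = 0 \<longleftrightarrow> A u \<in> vecs q {w. length w < d}" if "A u \<in> vecs q {w. length w < Suc d}" for u
    proof
      assume "f u = 0"
      then have "lookup (A u i) w = 0" if "length w = d" for i w
        using that lookup_component[of ?H "A u i" w] by (auto simp: f_def fun_eq_iff)
      then show "A u \<in> vecs q {w. length w < d}"
        using that unfolding vecs_iff by (metis less_SucE mem_Collect_eq)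
    next
      assume "A u \<in> vecs q {w. length w < d}"
      then show "f u = 0"
        by (intro vec_eqI) (auto simp: f_def vecs_iff)
    qed
    moreover have "A u \<in> vecs q {w. length w < Suc d}" if "A u \<in> vecs q {w. length w < d}" for u
      using that by (auto simp: vecs_iff less_Suc_eq)
    ultimately show ?thesis
      unfolding P_def by blast
  qed
  \<comment> \<open>A preimage of \<open>u\<close> is \<open>B u\<close>: the error
    \<open>A (B u) - u\<close> has only words shorter than \<open>d\<close> and does not reach the
    part of length \<open>d\<close>.\<close>
  have im: "f ` P (Suc d) = vecs q ?H"
  proof
    show "f ` P (Suc d) \<subseteq> vecs q ?H"
      by (auto simp: f_def P_def vecs_iff)
    show "vecs q ?H \<subseteq> f ` P (Suc d)"
    proof
      fix u :: "nat \<Rightarrow> 'x list \<Rightarrow>\<^sub>0 'f" assume u: "u \<in> vecs q ?H"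
      then have uU: "u \<in> vecs q UNIV" "u \<in> vecs q {w. length w < Suc d}"
        by (auto simp: vecs_iff)
      have *: "A (B u) - u \<in> vecs q {w. length w < d}"
        by (rule AB[OF uU(1)])
      then have "A (B u) - u \<in> vecs q {w. length w < Suc d}"
        by (auto simp: vecs_iff less_Suc_eq)
      from vec.subspace_add[OF subspace_vecs this uU(2)] have "B u \<in> P (Suc d)"
        using Bp by (simp add: P_def)
      moreover have "f (B u) = u"
      proof (rule vec_eqI)
        fix i w
        show "lookup (f (B u) i) w = lookup (u i) w"
        proof (cases "length w = d")
          case True
          then have "lookup ((A (B u) - u) i) w = 0"
            using * by (auto simp: vecs_iff)
          with True show ?thesis
            by (simp add: f_def lookup_minus)
        next
          case False
          then show ?thesis
            using u by (auto simp: f_def vecs_iff)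
        qed
      qed
      ultimately show "u \<in> f ` P (Suc d)"
        by (metis imageI)
    qed
  qed
  have "finite ?H"
    by (rule finite_subset[OF _ finite_length_less[of "Suc d"]]) auto
  then have "vec.dim (P (Suc d)) = vec.dim (P d) + q * CARD('x) ^ d"
    using vec_pair.rank_nullity_on[OF f sub[of "Suc d"]] fin
      fin_dim_vecs[of ?H q, where ?'f = 'f] dim_vecs[of ?H q, where ?'f = 'f]
    unfolding ker im by (simp add: card_length_eq)
  with dim1 show ?thesis
    by metis
qed

section \<open>Linear operators on finite combinations of words\<close>

abbreviation plinear :: "(('a \<Rightarrow>\<^sub>0 'f) \<Rightarrow> ('b \<Rightarrow>\<^sub>0 'f :: field)) \<Rightarrow> bool"
  where "plinear \<equiv> Vector_Spaces.linear pscale pscale"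

lemma plinear_iff:
  "plinear f \<longleftrightarrow> (\<forall>x y. f (x + y) = f x + f y) \<and> (\<forall>c x. f (pscale c x) = pscale c (f x))"
  by (auto simp: linear_iff intro: pvec.vector_space_axioms)

lemma plinear_id: "plinear (\<lambda>v. v)"
  by (simp add: plinear_iff)

lemma plinear_compose: "plinear f \<Longrightarrow> plinear g \<Longrightarrow> plinear (\<lambda>v. g (f v))"
  by (simp add: plinear_iff)

lemma plinear_diff: "plinear f \<Longrightarrow> plinear g \<Longrightarrow> plinear (\<lambda>v. f v - g v)"
  by (simp add: plinear_iff pvec.scale_right_diff_distrib)

lemma plinear_sum: "(\<And>i. i \<in> S \<Longrightarrow> plinear (f i)) \<Longrightarrow> plinear (\<lambda>v. \<Sum>i\<in>S. f i v)"
  by (simp add: plinear_iff sum.distrib pvec.scale_sum_right)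

lemma plinear_pscale: "plinear f \<Longrightarrow> plinear (\<lambda>v. pscale c (f v))"
  by (simp add: plinear_iff pvec.scale_right_distrib mult.commute)

lemma pscale_single [simp]: "pscale c (Poly_Mapping.single w a) = Poly_Mapping.single w (c * a)"
  by (rule poly_mapping_eqI) (simp add: lookup_single when_def)

definition lin_ext :: "('a \<Rightarrow> 'b \<Rightarrow>\<^sub>0 'f) \<Rightarrow> ('a \<Rightarrow>\<^sub>0 'f) \<Rightarrow> ('b \<Rightarrow>\<^sub>0 'f :: field)"
  where "lin_ext F v = (\<Sum>w\<in>keys v. pscale (lookup v w) (F w))"

lemma lin_ext_superset:
  assumes "finite S" and "keys v \<subseteq> S"
  shows "lin_ext F v = (\<Sum>w\<in>S. pscale (lookup v w) (F w))"
  unfolding lin_ext_def by (rule sum.mono_neutral_left) (use assms in \<open>auto simp: in_keys_iff\<close>)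

lemma plinear_lin_ext: "plinear (lin_ext F)"
proof -
  have "lin_ext F (x + y) = lin_ext F x + lin_ext F y" for x y
  proof -
    let ?S = "keys x \<union> keys y"
    have "lin_ext F (x + y) = (\<Sum>w\<in>?S. pscale (lookup (x + y) w) (F w))"
      by (rule lin_ext_superset) (simp_all add: Poly_Mapping.keys_add)
    also have "\<dots> = (\<Sum>w\<in>?S. pscale (lookup x w) (F w)) + (\<Sum>w\<in>?S. pscale (lookup y w) (F w))"
      by (simp add: lookup_add pvec.scale_left_distrib sum.distrib)
    also have "\<dots> = lin_ext F x + lin_ext F y"
      by (subst (1 2) lin_ext_superset[of ?S]) simp_all
    finally show ?thesis .
  qed
  moreover have "lin_ext F (pscale c x) = pscale c (lin_ext F x)" for c x
  proof -
    have "lin_ext F (pscale c x) = (\<Sum>w\<in>keys x. pscale (lookup (pscale c x) w) (F w))"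
      by (rule lin_ext_superset) (auto simp: in_keys_iff)
    then show ?thesis
      by (simp add: lin_ext_def pvec.scale_sum_right)
  qed
  ultimately show ?thesis
    by (simp add: plinear_iff)
qed

lemma lin_ext_single [simp]: "lin_ext F (Poly_Mapping.single w c) = pscale c (F w)"
  by (subst lin_ext_superset[of "{w}"]) simp_all

lemma plinear_eq_lin_ext:
  assumes "plinear f"
  shows "f v = lin_ext (\<lambda>w. f (Poly_Mapping.single w 1)) v"
proof -
  interpret Vector_Spaces.linear pscale pscale f
    by fact
  have v: "v = (\<Sum>w\<in>keys v. pscale (lookup v w) (Poly_Mapping.single w 1))"
  proof (rule poly_mapping_eqI)
    fix w
    have "lookup (\<Sum>w\<in>keys v. pscale (lookup v w) (Poly_Mapping.single w 1)) w
        = (\<Sum>w'\<in>keys v. if w' = w then lookup v w' else 0)"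
      unfolding lookup_sum by (rule sum.cong) (simp_all add: lookup_single when_def)
    then show "lookup v w = lookup (\<Sum>w\<in>keys v. pscale (lookup v w) (Poly_Mapping.single w 1)) w"
      by (simp add: in_keys_iff)
  qed
  have "f v = f (\<Sum>w\<in>keys v. pscale (lookup v w) (Poly_Mapping.single w 1))"
    using v by (rule arg_cong)
  also have "\<dots> = (\<Sum>w\<in>keys v. pscale (lookup v w) (f (Poly_Mapping.single w 1)))"
    unfolding sum scale ..
  finally show ?thesis
    unfolding lin_ext_def .
qed

lemma plinear_eqI:
  assumes "plinear f" and "plinear g"
    and "\<And>w. f (Poly_Mapping.single w 1) = g (Poly_Mapping.single w 1)"
  shows "f v = g v"
  unfolding plinear_eq_lin_ext[OF assms(1), of v] plinear_eq_lin_ext[OF assms(2), of v] assms(3) ..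

text \<open>The space of permitted errors. The bound is strict, so \<open>short 0\<close> is zero
  and \<open>short 1\<close> consists of the multiples of the empty word.\<close>

definition short :: "nat \<Rightarrow> ('x list \<Rightarrow>\<^sub>0 'f :: field) set"
  where "short m = {v. keys v \<subseteq> {w. length w < m}}"

lemma short_iff: "v \<in> short m \<longleftrightarrow> (\<forall>w. lookup v w \<noteq> 0 \<longrightarrow> length w < m)"
  by (auto simp: short_def in_keys_iff)

lemma subspace_short: "pvec.subspace (short m :: ('x list \<Rightarrow>\<^sub>0 'f :: field) set)"
proof (rule pvec.subspaceI)
  fix x y :: "'x list \<Rightarrow>\<^sub>0 'f" and c :: 'f
  assume x: "x \<in> short m"
  show "pscale c x \<in> short m"
    using x by (auto simp: short_iff)
  assume y: "y \<in> short m"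
  show "x + y \<in> short m"
    using x y Poly_Mapping.keys_add[of x y] unfolding short_def by blast
qed (simp add: short_iff)

lemma short_mono: "v \<in> short m \<Longrightarrow> m \<le> m' \<Longrightarrow> v \<in> short m'"
  by (auto simp: short_def)

lemma short_lin_ext:
  assumes "v \<in> short m" and "\<And>w. length w < m \<Longrightarrow> F w \<in> short m'"
  shows "lin_ext F v \<in> short m'"
  unfolding lin_ext_def
  by (intro pvec.subspace_sum[OF subspace_short] pvec.subspace_scale[OF subspace_short] assms(2))
    (use assms(1) in \<open>auto simp: short_def\<close>)

lemma plinear_short:
  assumes "plinear f" and "\<And>w. f (Poly_Mapping.single w 1) \<in> short m"
  shows "f v \<in> short m"
  unfolding plinear_eq_lin_ext[OF assms(1), of v] lin_ext_def
  by (intro pvec.subspace_sum[OF subspace_short] pvec.subspace_scale[OF subspace_short] assms(2))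

lemma plinear_deriv_last: "plinear (deriv_last j)"
  unfolding plinear_iff by (auto intro!: poly_mapping_eqI simp: lookup_add)

section \<open>Sums over the support of a product\<close>

lemma finite_support_polys: "f \<in> nc_polys X \<Longrightarrow> finite (nc_support f)"
  by (simp add: nc_polys_def)

lemma sum_support_superset:
  assumes "finite S" and "nc_support f \<subseteq> S" and "\<And>w. G w 0 = 0"
  shows "(\<Sum>w\<in>nc_support f. G w (nc_coeff f w)) = (\<Sum>w\<in>S. G w (nc_coeff f w))"
  by (rule sum.mono_neutral_left) (use assms in \<open>auto simp: nc_support_def\<close>)

text \<open>\<open>G w c\<close> stands for the value of the monomial \<open>w\<close> with
  coefficient \<open>c\<close>. This lemma and \<open>sum_support_mult\<close> serve both
  evaluations of polynomials that occur: the operators \<open>act\<close> and the substitution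
  \<open>nc_subst\<close>.\<close>

lemma sum_support_add:
  assumes "finite (nc_support f)" and "finite (nc_support g)"
    and G0: "\<And>w. G w 0 = 0" and G: "\<And>w a b. G w (a + b) = G w a + G w b"
  shows "(\<Sum>w\<in>nc_support (f + g). G w (nc_coeff (f + g) w))
    = (\<Sum>w\<in>nc_support f. G w (nc_coeff f w)) + (\<Sum>w\<in>nc_support g. G w (nc_coeff g w))"
proof -
  let ?S = "nc_support f \<union> nc_support g"
  have fin: "finite ?S"
    using assms by simp
  have sub: "nc_support (f + g) \<subseteq> ?S"
    by (auto simp: nc_support_def plus_nc_series_def)
  have "(\<Sum>w\<in>nc_support (f + g). G w (nc_coeff (f + g) w)) = (\<Sum>w\<in>?S. G w (nc_coeff (f + g) w))"
    by (rule sum_support_superset[where G = G, OF fin sub G0])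
  also have "\<dots> = (\<Sum>w\<in>?S. G w (nc_coeff f w)) + (\<Sum>w\<in>?S. G w (nc_coeff g w))"
    by (simp add: plus_nc_series_def G sum.distrib)
  also have "\<dots> = (\<Sum>w\<in>nc_support f. G w (nc_coeff f w)) + (\<Sum>w\<in>nc_support g. G w (nc_coeff g w))"
    using sum_support_superset[where G = G, OF fin, of f] sum_support_superset[where G = G, OF fin, of g] G0 by simp
  finally show ?thesis .
qed

text \<open>The cut positions \<open>i\<close> of \<open>w\<close> correspond to the factorizations
  of \<open>w\<close> into two words; those outside the supports contribute zero.\<close>

lemma nc_coeff_mult_sum:
  assumes "finite (nc_support f)" and "finite (nc_support g)"
  shows "nc_coeff (f * g) w
    = (\<Sum>p\<in>{p \<in> nc_support f \<times> nc_support g. fst p @ snd p = w}. nc_coeff f (fst p) * nc_coeff g (snd p))"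
proof -
  let ?h = "\<lambda>i. (take i w, drop i w)"
  have inj: "inj_on ?h {..length w}"
    by (rule inj_on_inverseI[where g = "\<lambda>p. length (fst p)"]) auto
  have img: "?h ` {..length w} = {p. fst p @ snd p = w}"
  proof
    show "{p. fst p @ snd p = w} \<subseteq> ?h ` {..length w}"
    proof
      fix p assume "p \<in> {p. fst p @ snd p = w}"
      then show "p \<in> ?h ` {..length w}"
        by (intro image_eqI[of _ _ "length (fst p)"]) (auto simp: prod_eq_iff)
    qed
  qed auto
  have "nc_coeff (f * g) w = (\<Sum>i\<le>length w. nc_coeff f (fst (?h i)) * nc_coeff g (snd (?h i)))"
    by (simp add: times_nc_series_def)
  also have "\<dots> = (\<Sum>p\<in>?h ` {..length w}. nc_coeff f (fst p) * nc_coeff g (snd p))"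
    by (simp add: sum.reindex[OF inj])
  also note img
  also have "(\<Sum>p\<in>{p. fst p @ snd p = w}. nc_coeff f (fst p) * nc_coeff g (snd p))
      = (\<Sum>p\<in>{p \<in> nc_support f \<times> nc_support g. fst p @ snd p = w}. nc_coeff f (fst p) * nc_coeff g (snd p))"
  proof (rule sum.mono_neutral_right)
    show "finite {p. fst p @ snd p = w}"
      unfolding img[symmetric] by simp
    show "\<forall>p\<in>{p. fst p @ snd p = w} - {p \<in> nc_support f \<times> nc_support g. fst p @ snd p = w}.
        nc_coeff f (fst p) * nc_coeff g (snd p) = 0"
      by (auto simp: nc_support_def)
  qed auto
  finally show ?thesis .
qed

text \<open>Pairs of words are grouped by their concatenation, and additivity of \<open>G\<close> in
  the coefficient distributes it over each group.\<close>

lemma sum_support_mult: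
  assumes f: "finite (nc_support f)" and g: "finite (nc_support g)"
    and G0: "\<And>w. G w 0 = 0" and G: "\<And>w a b. G w (a + b) = G w a + G w b"
  shows "(\<Sum>w\<in>nc_support (f * g). G w (nc_coeff (f * g) w))
    = (\<Sum>u\<in>nc_support f. \<Sum>v\<in>nc_support g. G (u @ v) (nc_coeff f u * nc_coeff g v))"
proof -
  let ?S = "nc_support f \<times> nc_support g"
  let ?h = "\<lambda>p. fst p @ snd p"
  have fin: "finite ?S"
    using f g by simp
  have Gsum: "G w (\<Sum>x\<in>A. a x) = (\<Sum>x\<in>A. G w (a x))" for w a and A :: "('a list \<times> 'a list) set"
    by (induction A rule: infinite_finite_induct) (simp_all add: G0 G)
  have sub: "nc_support (f * g) \<subseteq> ?h ` ?S"
    using nc_support_mult[of f g] by (simp add: case_prod_beta)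
  have "(\<Sum>w\<in>nc_support (f * g). G w (nc_coeff (f * g) w)) = (\<Sum>w\<in>?h ` ?S. G w (nc_coeff (f * g) w))"
    by (rule sum_support_superset[where G = G, OF _ sub G0]) (use fin in simp)
  also have "\<dots> = (\<Sum>w\<in>?h ` ?S. \<Sum>p\<in>{p \<in> ?S. ?h p = w}. G (?h p) (nc_coeff f (fst p) * nc_coeff g (snd p)))"
    unfolding nc_coeff_mult_sum[OF f g] Gsum by (intro sum.cong) auto
  also have "\<dots> = (\<Sum>p\<in>?S. G (?h p) (nc_coeff f (fst p) * nc_coeff g (snd p)))"
    by (rule sum.group) (use fin in auto)
  also have "\<dots> = (\<Sum>u\<in>nc_support f. \<Sum>v\<in>nc_support g. G (u @ v) (nc_coeff f u * nc_coeff g v))"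
    by (simp add: sum.cartesian_product case_prod_beta)
  finally show ?thesis .
qed

lemma nc_coeff_add [simp]: "nc_coeff (f + g) w = nc_coeff f w + nc_coeff g w"
  by (simp add: plus_nc_series_def)

lemma nc_coeff_0 [simp]: "nc_coeff 0 w = 0"
  by (simp add: zero_nc_series_def)

lemma nc_coeff_const: "nc_coeff (nc_const c) w = (if w = [] then c else 0)"
  by (simp add: nc_const_def)

lemma nc_coeff_var: "nc_coeff (nc_var x) w = (if w = [x] then 1 else 0)"
  by (simp add: nc_var_def)

lemma nc_coeff_mult: "nc_coeff (f * g) w = (\<Sum>i\<le>length w. nc_coeff f (take i w) * nc_coeff g (drop i w))"
  by (simp add: times_nc_series_def)

lemma nc_const_1: "nc_const 1 = 1"
  by (simp add: nc_const_def one_nc_series_def)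

lemma nc_const_0: "nc_const 0 = 0"
  by (simp add: nc_const_def zero_nc_series_def)

lemma nc_coeff_const_mult [simp]: "nc_coeff (nc_const c * f) w = c * nc_coeff f w"
proof -
  have "nc_coeff (nc_const c * f) w = (\<Sum>i\<le>length w. if i = 0 then c * nc_coeff f w else 0)"
    unfolding nc_coeff_mult by (intro sum.cong) (auto simp: nc_coeff_const)
  then show ?thesis by simp
qed

lemma nc_coeff_mult_const [simp]: "nc_coeff (f * nc_const c) w = nc_coeff f w * c"
proof -
  have "nc_coeff (f * nc_const c) w = (\<Sum>i\<le>length w. if i = length w then nc_coeff f w * c else 0)"
    unfolding nc_coeff_mult by (intro sum.cong) (auto simp: nc_coeff_const)
  then show ?thesis by simp
qed

lemma nc_var_poly: "x \<in> X \<Longrightarrow> nc_var x \<in> nc_polys X"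
  by (rule nc_polysI[of _ "{[x]}"]) (auto simp: nc_support_def nc_coeff_var)

lemma sum_in_polys: "(\<And>i. i \<in> S \<Longrightarrow> f i \<in> nc_polys X) \<Longrightarrow> (\<Sum>i\<in>S. f i) \<in> nc_polys X"
  by (induction S rule: infinite_finite_induct) (simp_all add: nc_polys_0 nc_polys_add)

lemma nc_const_poly: "nc_const c \<in> nc_polys X"
  by (rule nc_polysI[of _ "{[]}"]) (auto simp: nc_support_def nc_coeff_const)

section \<open>The action of the generators on words\<close>

type_synonym ('x, 'k) words = "'x list \<Rightarrow>\<^sub>0 'k resfield"

text \<open>Transposed left multiplication: a prefix is removed and its coefficient in
  \<open>r\<close>, reduced to the residue field, is the weight. A word has finitely many prefixes,
  so series with infinite support act on finite combinations as well.\<close>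

definition base_act :: "('x, 'k :: comm_ring_1) nc_series \<Rightarrow> ('x, 'k) words \<Rightarrow> ('x, 'k) words"
  where "base_act r = lin_ext (\<lambda>w. \<Sum>i\<le>length w.
    Poly_Mapping.single (drop i w) (res (nc_coeff r (take i w))))"

definition star_act :: "'x \<Rightarrow> ('x, 'k :: comm_ring_1) words \<Rightarrow> ('x, 'k) words"
  where "star_act i = lin_ext (\<lambda>w. Poly_Mapping.single (i # w) 1)"

definition gen_act :: "('x, 'k :: comm_ring_1) nc_series + 'x \<Rightarrow> ('x, 'k) words \<Rightarrow> ('x, 'k) words"
  where "gen_act g = case_sum base_act star_act g"

text \<open>The algebra acts on the right: the first letter of a word of generators acts first.\<close>

definition act :: "(('x, 'k) nc_series + 'x, 'k :: comm_ring_1) nc_series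
    \<Rightarrow> ('x, 'k) words \<Rightarrow> ('x, 'k) words"
  where "act f v = (\<Sum>w\<in>nc_support f. pscale (res (nc_coeff f w)) (fold gen_act w v))"

lemma plinear_gen_act: "plinear (gen_act g)"
  by (cases g) (simp_all add: gen_act_def base_act_def star_act_def plinear_lin_ext)

lemma plinear_fold_gen_act: "plinear (fold gen_act w)"
proof (induction w)
  case (Cons g w)
  from plinear_compose[OF plinear_gen_act this] show ?case
    by (simp add: o_def)
qed (simp add: plinear_id id_def)

lemma plinear_act: "plinear (act f)"
  unfolding act_def by (intro plinear_sum plinear_pscale plinear_fold_gen_act)

lemma act_add:
  assumes "f \<in> nc_polys X" and "g \<in> nc_polys Y"
  shows "act (f + g) v = act f v + act g v"
  unfolding act_def
  by (rule sum_support_add) (use assms in \<open>simp_all add: finite_support_polys pvec.scale_left_distrib\<close>)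

text \<open>A concatenation \<open>u @ w\<close> runs \<open>u\<close> first and then
  \<open>w\<close>, which is why the factors appear in reversed order as operators.\<close>

lemma act_mult:
  assumes f: "f \<in> nc_polys X" and g: "g \<in> nc_polys Y"
  shows "act (f * g) v = act g (act f v)"
proof -
  let ?G = "\<lambda>w c. pscale (res c) (fold gen_act w v)"
  interpret W: Vector_Spaces.linear pscale pscale "fold gen_act w" for w :: "(('a, 'b) nc_series + 'a) list"
    by (rule plinear_fold_gen_act)
  have "act (f * g) v = (\<Sum>u\<in>nc_support f. \<Sum>w\<in>nc_support g. ?G (u @ w) (nc_coeff f u * nc_coeff g w))"
    unfolding act_def
    by (rule sum_support_mult[where G = ?G])
      (use f g in \<open>simp_all add: finite_support_polys pvec.scale_left_distrib\<close>)
  also have "\<dots> = (\<Sum>w\<in>nc_support g. \<Sum>u\<in>nc_support f.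
      pscale (res (nc_coeff g w)) (fold gen_act w (pscale (res (nc_coeff f u)) (fold gen_act u v))))"
    by (subst sum.swap) (simp add: W.scale mult.commute)
  also have "\<dots> = act g (act f v)"
    unfolding act_def W.sum pvec.scale_sum_right ..
  finally show ?thesis .
qed

lemma act_0 [simp]: "act 0 v = 0"
  by (simp add: act_def nc_support_def)

lemma act_uminus: "f \<in> nc_polys X \<Longrightarrow> act (- f) v = - act f v"
  using act_add[of f X "- f" X v] by (simp add: nc_polys_uminus eq_neg_iff_add_eq_0 add.commute)

lemma act_diff: "f \<in> nc_polys X \<Longrightarrow> g \<in> nc_polys Y \<Longrightarrow> act (f - g) v = act f v - act g v"
  using act_add[of f X "- g" Y v] by (simp add: nc_polys_uminus act_uminus)

lemma act_sum: "(\<And>i. i \<in> S \<Longrightarrow> f i \<in> nc_polys X) \<Longrightarrow> act (\<Sum>i\<in>S. f i) v = (\<Sum>i\<in>S. act (f i) v)"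
proof (induction S rule: infinite_finite_induct)
  case (insert i S)
  have "(\<Sum>i\<in>S. f i) \<in> nc_polys X"
    using insert.prems by (intro sum_in_polys) auto
  then show ?case
    using insert by (simp add: act_add[of _ X _ X])
qed simp_all

lemma act_const [simp]: "act (nc_const c) v = pscale (res c) v"
proof -
  have "act (nc_const c) v = (\<Sum>w\<in>{[]}. pscale (res (nc_coeff (nc_const c) w)) (fold gen_act w v))"
    unfolding act_def by (rule sum_support_superset) (auto simp: nc_support_def nc_coeff_const)
  then show ?thesis
    by (simp add: nc_coeff_const)
qed

lemma act_1 [simp]: "act 1 v = v"
  using act_const[of 1 v] by (simp add: nc_const_1)

lemma act_var [simp]: "act (nc_var g) v = gen_act g v"
proof -
  have "act (nc_var g) v = (\<Sum>w\<in>{[g]}. pscale (res (nc_coeff (nc_var g) w)) (fold gen_act w v))"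
    unfolding act_def by (rule sum_support_superset) (auto simp: nc_support_def nc_coeff_var)
  then show ?thesis
    by (simp add: nc_coeff_var)
qed

lemma plinear_base_act: "plinear (base_act r)"
  by (simp add: base_act_def plinear_lin_ext)

lemma plinear_star_act: "plinear (star_act i)"
  by (simp add: star_act_def plinear_lin_ext)

lemma base_act_single: "base_act r (Poly_Mapping.single w 1)
    = (\<Sum>i\<le>length w. Poly_Mapping.single (drop i w) (res (nc_coeff r (take i w))))"
  by (simp add: base_act_def)

lemma star_act_single [simp]: "star_act i (Poly_Mapping.single w 1) = Poly_Mapping.single (i # w) 1"
  by (simp add: star_act_def)

lemma base_act_add: "base_act (r + s) v = base_act r v + base_act s v"
proof (rule plinear_eqI[where v = v])
  show "plinear (\<lambda>v. base_act r v + base_act s v)"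
    using plinear_base_act[of r] plinear_base_act[of s]
    by (simp add: plinear_iff pvec.scale_right_distrib ac_simps)
qed (simp_all add: plinear_base_act base_act_single sum.distrib single_add)

text \<open>Removing a prefix weighted by \<open>r * s\<close> means removing a prefix weighted by
  \<open>r\<close> and then one of the remaining word weighted by \<open>s\<close>; the reindexing
  is that of the associativity of the product of series.\<close>

lemma base_act_mult: "base_act (r * s) v = base_act s (base_act r v)"
proof (rule plinear_eqI[where v = v])
  show "plinear (base_act (r * s))"
    by (rule plinear_base_act)
  show "plinear (\<lambda>v. base_act s (base_act r v))"
    by (rule plinear_compose[OF plinear_base_act plinear_base_act])
  fix w :: "'a list"
  interpret S: Vector_Spaces.linear pscale pscale "base_act s"
    by (rule plinear_base_act)
  define n where "n = length w"
  define t where "t j k = Poly_Mapping.single (drop (k + j) w)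
    (res (nc_coeff r (take j w) * nc_coeff s (take k (drop j w))))" for j k
  have res_sum: "res (\<Sum>i\<in>A. f i) = (\<Sum>i\<in>A. res (f i))" for f :: "nat \<Rightarrow> 'b" and A
    by (induction A rule: infinite_finite_induct) simp_all
  have single_sum: "Poly_Mapping.single w (\<Sum>i\<in>A. f i) = (\<Sum>i\<in>A. Poly_Mapping.single w (f i))"
    for w and f :: "nat \<Rightarrow> 'b resfield" and A
    by (induction A rule: infinite_finite_induct) (simp_all add: single_add)
  have "base_act (r * s) (Poly_Mapping.single w 1) = (\<Sum>i\<le>n. \<Sum>j\<le>i. t j (i - j))"
    unfolding base_act_single nc_coeff_mult res_sum single_sum
    by (intro sum.cong) (simp_all add: drop_take t_def n_def)
  also have "\<dots> = (\<Sum>(j, k)\<in>{(j, k). j + k \<le> n}. t j k)"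
    by (rule sum.triangle_reindex_eq [symmetric])
  also have "{(j, k). j + k \<le> n} = (SIGMA j:{..n}. {..n - j})"
    by auto
  also have "(\<Sum>(j, k)\<in>(SIGMA j:{..n}. {..n - j}). t j k) = (\<Sum>j\<le>n. \<Sum>k\<le>n - j. t j k)"
    by (rule sum.Sigma [symmetric]) auto
  also have "\<dots> = base_act s (base_act r (Poly_Mapping.single w 1))"
  proof -
    have "base_act s (Poly_Mapping.single u c) = (\<Sum>i\<le>length u.
        Poly_Mapping.single (drop i u) (c * res (nc_coeff s (take i u))))" for u c
      by (simp add: base_act_def pvec.scale_sum_right)
    then show ?thesis
      unfolding base_act_single S.sum by (intro sum.cong) (simp_all add: t_def n_def)
  qed
  finally show "base_act (r * s) (Poly_Mapping.single w 1) = base_act s (base_act r (Poly_Mapping.single w 1))" .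
qed

lemma base_act_const: "base_act (nc_const c) v = pscale (res c) v"
proof (rule plinear_eqI[where v = v])
  fix w :: "'a list"
  have "base_act (nc_const c) (Poly_Mapping.single w 1)
      = (\<Sum>i\<le>length w. if i = 0 then Poly_Mapping.single w (res c) else 0)"
    unfolding base_act_single by (intro sum.cong) (auto simp: nc_coeff_const)
  then show "base_act (nc_const c) (Poly_Mapping.single w 1) = pscale (res c) (Poly_Mapping.single w 1)"
    by simp
qed (simp_all add: plinear_base_act plinear_pscale plinear_id)

lemma base_act_var_single: "base_act (nc_var j) (Poly_Mapping.single w 1)
    = (if w \<noteq> [] \<and> hd w = j then Poly_Mapping.single (tl w) 1 else 0)"
proof -
  have "base_act (nc_var j) (Poly_Mapping.single w 1)
      = (\<Sum>i\<le>length w. if i = 1 then (if w \<noteq> [] \<and> hd w = j then Poly_Mapping.single (tl w) 1 else 0) else 0)"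
    unfolding base_act_single
  proof (intro sum.cong refl)
    fix i assume "i \<in> {..length w}"
    then show "Poly_Mapping.single (drop i w) (res (nc_coeff (nc_var j) (take i w)))
      = (if i = 1 then (if w \<noteq> [] \<and> hd w = j then Poly_Mapping.single (tl w) 1 else 0) else 0)"
      by (cases w; cases i; cases "i - 1") (auto simp: nc_coeff_var)
  qed
  then show ?thesis
    by (simp only: sum.delta finite_atMost) (cases w; simp)
qed

lemma base_var_star: "base_act (nc_var j) (star_act i v) = (if i = j then v else 0)"
proof (rule plinear_eqI[where v = v])
  show "plinear (\<lambda>v. base_act (nc_var j) (star_act i v))"
    by (rule plinear_compose[OF plinear_star_act plinear_base_act])
  show "plinear (\<lambda>v. if i = j then v else 0)"
    by (simp add: plinear_iff)
qed (simp add: base_act_var_single)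

text \<open>Removing the first letter and putting it back restores every nonempty word. The empty
  word has no first letter and is sent to zero, so the difference is a multiple of the empty
  word.\<close>

lemma sum_star_base_var:
  fixes v :: "('x :: finite, 'k :: comm_ring_1) words"
  shows "(\<Sum>i\<in>UNIV. star_act i (base_act (nc_var i) v)) - v \<in> short 1"
proof (rule plinear_short[where v = v])
  show "plinear (\<lambda>v :: ('x, 'k) words. (\<Sum>i\<in>UNIV. star_act i (base_act (nc_var i) v)) - v)"
    by (intro plinear_diff plinear_sum plinear_compose[OF plinear_base_act plinear_star_act] plinear_id)
  fix w :: "'x list"
  interpret S: Vector_Spaces.linear pscale pscale "star_act i :: ('x, 'k) words \<Rightarrow> _" for i
    by (rule plinear_star_act)
  have "(\<Sum>i\<in>UNIV. star_act i (base_act (nc_var i) (Poly_Mapping.single w 1)))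
      = (\<Sum>i\<in>UNIV. if i = hd w then if w \<noteq> [] then Poly_Mapping.single w 1 else 0 else 0 :: ('x, 'k) words)"
    by (intro sum.cong) (auto simp: base_act_var_single)
  also have "\<dots> = (if w \<noteq> [] then Poly_Mapping.single w 1 else 0)"
    by simp
  finally show "(\<Sum>i\<in>UNIV. star_act i (base_act (nc_var i) (Poly_Mapping.single w 1)))
      - Poly_Mapping.single w (1 :: 'k resfield) \<in> short 1"
    by (auto simp: short_iff lookup_single when_def)
qed

lemma short_sum: "(\<And>i. i \<in> S \<Longrightarrow> f i \<in> short m) \<Longrightarrow> (\<Sum>i\<in>S. f i) \<in> short m"
  by (rule pvec.subspace_sum[OF subspace_short])

lemma short_pscale: "v \<in> short m \<Longrightarrow> pscale c v \<in> short m"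
  by (rule pvec.subspace_scale[OF subspace_short])

lemma short_add: "v \<in> short m \<Longrightarrow> w \<in> short m \<Longrightarrow> v + w \<in> short m"
  by (rule pvec.subspace_add[OF subspace_short])

lemma short_uminus: "v \<in> short m \<Longrightarrow> - v \<in> short m"
  by (rule pvec.subspace_neg[OF subspace_short])

text \<open>Only a \<open>star_gen\<close> lengthens words, and by one letter; a
  \<open>base_gen\<close> never does.\<close>

lemma gen_act_short:
  assumes "v \<in> short m"
  shows "gen_act g v \<in> short (Suc m)"
proof (cases g)
  case (Inl r)
  have "base_act r v \<in> short (Suc m)"
    unfolding base_act_def
    by (rule short_lin_ext[OF assms], rule short_sum) (auto simp: short_iff lookup_single when_def)
  with Inl show ?thesis
    by (simp add: gen_act_def)
next
  case (Inr i)
  have "star_act i v \<in> short (Suc m)"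
    unfolding star_act_def
    by (rule short_lin_ext[OF assms]) (auto simp: short_iff lookup_single when_def)
  with Inr show ?thesis
    by (simp add: gen_act_def)
qed

lemma fold_gen_act_short: "v \<in> short m \<Longrightarrow> fold gen_act w v \<in> short (m + length w)"
proof (induction w arbitrary: v m)
  case (Cons g w)
  from Cons.IH[OF gen_act_short[OF Cons.prems, of g]] show ?case
    by simp
qed simp

lemma act_short:
  assumes "f \<in> nc_polys X"
  obtains e where "\<And>v m. v \<in> short m \<Longrightarrow> act f v \<in> short (m + e)"
proof -
  \<comment> \<open>The largest number of generators in a monomial of \<open>f\<close>; inserting
    \<open>0\<close> covers \<open>f = 0\<close>, where \<open>Max\<close> would range over the
    empty set.\<close>
  define e where "e = Max (insert 0 (length ` nc_support f))"
  have e: "length w \<le> e" if "w \<in> nc_support f" for w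
    unfolding e_def using assms that by (intro Max_ge) (auto simp: finite_support_polys)
  have "act f v \<in> short (m + e)" if "v \<in> short m" for v m
    unfolding act_def
    by (intro short_sum short_pscale short_mono[OF fold_gen_act_short[OF that]]) (simp add: e)
  with that show thesis by blast
qed

lemma deriv_last_single: "deriv_last j (Poly_Mapping.single w c)
    = (if w \<noteq> [] \<and> last w = j then Poly_Mapping.single (butlast w) c else 0)"
  by (rule poly_mapping_eqI) (auto simp: lookup_single when_def)

text \<open>Generators work at the front, deletion at the end, and the two interfere only on the
  empty word: \<open>star_act i\<close> turns it into \<open>[i]\<close>, whose last letter can be
  deleted, while deletion before \<open>star_act i\<close> gives zero. For a \<open>base_gen\<close>
  the commutation is exact.\<close>

lemma deriv_last_gen_act: "deriv_last j (gen_act g v) - gen_act g (deriv_last j v) \<in> short 1"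
proof (rule plinear_short[where v = v])
  show "plinear (\<lambda>v. deriv_last j (gen_act g v) - gen_act g (deriv_last j v))"
    by (intro plinear_diff plinear_compose[OF plinear_gen_act plinear_deriv_last]
        plinear_compose[OF plinear_deriv_last plinear_gen_act])
  interpret D: Vector_Spaces.linear pscale pscale "deriv_last j"
    by (rule plinear_deriv_last)
  interpret G: Vector_Spaces.linear pscale pscale "gen_act g"
    by (rule plinear_gen_act)
  fix w :: "'a list"
  show "deriv_last j (gen_act g (Poly_Mapping.single w 1)) - gen_act g (deriv_last j (Poly_Mapping.single w 1)) \<in> short 1"
  proof (cases g)
    case (Inr i)
    then show ?thesis
      using G.zero by (cases "w = []") (auto simp: gen_act_def deriv_last_single short_iff lookup_single when_def)
  next
    case (Inl r)
    have "deriv_last j (base_act r (Poly_Mapping.single w 1)) = base_act r (deriv_last j (Poly_Mapping.single w 1))"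
    proof (cases w rule: rev_cases)
      case Nil
      then show ?thesis
        using G.zero Inl by (simp add: gen_act_def base_act_single deriv_last_single)
    next
      case (snoc w' i)
      have "deriv_last j (base_act r (Poly_Mapping.single w 1))
          = (\<Sum>l\<le>Suc (length w'). deriv_last j (Poly_Mapping.single (drop l w) (res (nc_coeff r (take l w)))))"
        unfolding base_act_single D.sum by (simp add: snoc)
      \<comment> \<open>The summand for \<open>l = Suc (length w')\<close> removes the whole word;
        what it leaves is a multiple of the empty word, which \<open>deriv_last\<close>
        kills.\<close>
      also have "\<dots> = (\<Sum>l\<le>length w'. if i = j then Poly_Mapping.single (drop l w') (res (nc_coeff r (take l w'))) else 0)"
        by (simp add: snoc deriv_last_single) (intro sum.cong, simp_all)
      also have "\<dots> = base_act r (deriv_last j (Poly_Mapping.single w 1))"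
        using G.zero Inl by (simp add: gen_act_def snoc deriv_last_single base_act_single)
      finally show ?thesis .
    qed
    with Inl show ?thesis
      by (simp add: gen_act_def short_iff)
  qed
qed

text \<open>The error of one generator is a multiple of the empty word, and each later generator
  lengthens it by at most one letter. The bound therefore depends on \<open>w\<close> but not on
  \<open>v\<close>.\<close>

lemma deriv_last_fold_gen_act:
  "deriv_last j (fold gen_act w v) - fold gen_act w (deriv_last j v) \<in> short (Suc (length w))"
proof (induction w arbitrary: v)
  case Nil
  then show ?case
    by (simp add: short_iff)
next
  case (Cons g w)
  interpret W: Vector_Spaces.linear pscale pscale "fold gen_act w"
    by (rule plinear_fold_gen_act)
  have "deriv_last j (fold gen_act w (gen_act g v)) - fold gen_act w (deriv_last j (gen_act g v)) \<in> short (Suc (length w))"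
    by (rule Cons.IH)
  moreover have "fold gen_act w (deriv_last j (gen_act g v) - gen_act g (deriv_last j v)) \<in> short (Suc (length w))"
    using fold_gen_act_short[OF deriv_last_gen_act, of w] by simp
  ultimately have "deriv_last j (fold gen_act w (gen_act g v)) - fold gen_act w (gen_act g (deriv_last j v))
      \<in> short (Suc (length w))"
    using pvec.subspace_add[OF subspace_short] unfolding W.diff by fastforce
  then show ?case
    using short_mono by fastforce
qed

lemma deriv_last_act:
  assumes "f \<in> nc_polys X"
  obtains d where "\<And>j v. deriv_last j (act f v) - act f (deriv_last j v) \<in> short d"
proof -
  define e where "e = Max (insert 0 (length ` nc_support f))"
  have e: "length w \<le> e" if "w \<in> nc_support f" for w
    unfolding e_def using assms that by (intro Max_ge) (auto simp: finite_support_polys)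
  have "deriv_last j (act f v) - act f (deriv_last j v) \<in> short (Suc e)" for j v
  proof -
    interpret D: Vector_Spaces.linear pscale pscale "deriv_last j"
      by (rule plinear_deriv_last)
    have "deriv_last j (act f v) - act f (deriv_last j v) = (\<Sum>w\<in>nc_support f.
        pscale (res (nc_coeff f w)) (deriv_last j (fold gen_act w v) - fold gen_act w (deriv_last j v)))"
      by (simp add: act_def D.sum D.scale sum_subtractf pvec.scale_right_diff_distrib)
    also have "\<dots> \<in> short (Suc e)"
      by (intro short_sum short_pscale short_mono[OF deriv_last_fold_gen_act]) (simp add: e)
    finally show ?thesis .
  qed
  with that show thesis by blast
qed

section \<open>The Leavitt localization\<close>

definition leavitt_gens :: "('x, 'k) nc_series set \<Rightarrow> (('x, 'k) nc_series + 'x) set"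
  where "leavitt_gens R = Inl ` R \<union> range Inr"

abbreviation leavitt_polys ::
    "('x, 'k :: ring_1) nc_series set \<Rightarrow> (('x, 'k) nc_series + 'x, 'k) nc_series set"
  where "leavitt_polys R \<equiv> nc_polys (leavitt_gens R)"

abbreviation leavitt_ring ::
    "('x, 'k :: ring_1) nc_series set \<Rightarrow> (('x, 'k) nc_series + 'x, 'k) nc_series ring"
  where "leavitt_ring R \<equiv> nc_poly_ring (leavitt_gens R)"

definition leavitt_ideal ::
    "('x :: finite, 'k :: ring_1) nc_series set \<Rightarrow> (('x, 'k) nc_series + 'x, 'k) nc_series set"
  where "leavitt_ideal R = Idl\<^bsub>leavitt_ring R\<^esub> (leavitt_relations R)"

definition leavitt_class ::
    "('x :: finite, 'k :: ring_1) nc_series set \<Rightarrow> (('x, 'k) nc_series + 'x, 'k) nc_series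
      \<Rightarrow> (('x, 'k) nc_series + 'x, 'k) nc_series set"
  where "leavitt_class R a = leavitt_ideal R +>\<^bsub>leavitt_ring R\<^esub> a"

lemma leavitt_localization_eq: "leavitt_localization R = leavitt_ring R Quot leavitt_ideal R"
  by (simp add: leavitt_localization_def leavitt_ideal_def leavitt_gens_def Let_def)

lemma nc_poly_ring_simps [simp]:
  "carrier (nc_poly_ring X) = nc_polys X" "a \<otimes>\<^bsub>nc_poly_ring X\<^esub> b = a * b"
  "\<one>\<^bsub>nc_poly_ring X\<^esub> = 1" "\<zero>\<^bsub>nc_poly_ring X\<^esub> = 0" "a \<oplus>\<^bsub>nc_poly_ring X\<^esub> b = a + b"
  by (simp_all add: nc_poly_ring_def)

lemma nc_poly_ring_uminus:
  assumes "a \<in> nc_polys X"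
  shows "\<ominus>\<^bsub>nc_poly_ring X\<^esub> a = - a"
proof -
  interpret ring "nc_poly_ring X"
    by (rule ring_nc_poly_ring)
  show ?thesis
    using assms by (intro minus_equality) (simp_all add: nc_polys_uminus)
qed

lemma nc_poly_ring_minus:
  "a \<in> nc_polys X \<Longrightarrow> b \<in> nc_polys X \<Longrightarrow> a \<ominus>\<^bsub>nc_poly_ring X\<^esub> b = a - b"
  by (simp add: a_minus_def nc_poly_ring_uminus)

text \<open>Over a finite alphabet these operators have finite rank; they are the ones neglected,
  much as compact operators are in a Calkin algebra. The bound is uniform in
  \<open>v\<close>.\<close>

definition bounded_act :: "(('x, 'k) nc_series + 'x, 'k :: comm_ring_1) nc_series \<Rightarrow> bool"
  where "bounded_act f \<longleftrightarrow> (\<exists>d. \<forall>v. act f v \<in> short d)"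

lemma bounded_act_add:
  assumes "f \<in> nc_polys X" "g \<in> nc_polys X" "bounded_act f" "bounded_act g"
  shows "bounded_act (f + g)"
proof -
  from assms(3,4) obtain d e where "\<And>v. act f v \<in> short d" "\<And>v. act g v \<in> short e"
    unfolding bounded_act_def by blast
  then have "act f v \<in> short (max d e)" "act g v \<in> short (max d e)" for v
    by (meson short_mono max.cobounded1 max.cobounded2)+
  then have "act (f + g) v \<in> short (max d e)" for v
    by (simp add: act_add[OF assms(1,2)] short_add)
  then show ?thesis
    unfolding bounded_act_def by blast
qed

text \<open>In \<open>g * f\<close> the bounded factor acts last, so its bound remains. In
  \<open>f * g\<close> the factor \<open>g\<close> acts on words of bounded length and lengthens
  them by a bounded amount.\<close>

lemma ideal_bounded_act:
  fixes X :: "(('x, 'k :: comm_ring_1) nc_series + 'x) set"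
  shows "ideal {f \<in> nc_polys X. bounded_act f} (nc_poly_ring X)"
proof (rule idealI)
  show "ring (nc_poly_ring X)"
    by (rule ring_nc_poly_ring)
  show "subgroup {f \<in> nc_polys X. bounded_act f} (add_monoid (nc_poly_ring X))"
  proof
    fix f
    assume f: "f \<in> {f \<in> nc_polys X. bounded_act f}"
    then have "bounded_act (- f)"
      by (auto simp: bounded_act_def act_uminus[of f X] intro: short_uminus)
    with f show "inv\<^bsub>add_monoid (nc_poly_ring X)\<^esub> f \<in> {f \<in> nc_polys X. bounded_act f}"
      unfolding a_inv_def[symmetric] by (simp add: nc_poly_ring_uminus nc_polys_uminus)
  qed (auto simp: nc_polys_0 nc_polys_add bounded_act_add bounded_act_def[of 0] short_iff)
  fix f g :: "(('x, 'k) nc_series + 'x, 'k) nc_series"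
  assume "f \<in> {f \<in> nc_polys X. bounded_act f}" and "g \<in> carrier (nc_poly_ring X)"
  then have f: "f \<in> nc_polys X" and g: "g \<in> nc_polys X" and fb: "bounded_act f"
    by auto
  from fb obtain d where d: "\<And>v. act f v \<in> short d"
    unfolding bounded_act_def by blast
  have "bounded_act (g * f)"
    unfolding bounded_act_def act_mult[OF g f] using d by blast
  with f g show "g \<otimes>\<^bsub>nc_poly_ring X\<^esub> f \<in> {f \<in> nc_polys X. bounded_act f}"
    by (simp add: nc_polys_mult)
  obtain e where "\<And>v m. v \<in> short m \<Longrightarrow> act g v \<in> short (m + e)"
    using act_short[OF g] by blast
  then have "bounded_act (f * g)"
    unfolding bounded_act_def act_mult[OF f g] using d by blast
  with f g show "f \<otimes>\<^bsub>nc_poly_ring X\<^esub> g \<in> {f \<in> nc_polys X. bounded_act f}"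
    by (simp add: nc_polys_mult)
qed

section \<open>Matrices of polynomials as operators on tuples, and the arithmetic of their
  ranks\<close>

lemma uniform_bound:
  fixes C :: "'i \<Rightarrow> nat \<Rightarrow> bool"
  assumes "finite S" and "\<And>i. i \<in> S \<Longrightarrow> \<exists>d. C i d" and mono: "\<And>i d e. C i d \<Longrightarrow> d \<le> e \<Longrightarrow> C i e"
  shows "\<exists>d. \<forall>i\<in>S. C i d"
  using assms(1,2)
proof (induction S)
  case (insert i S)
  then obtain d e where "\<forall>i\<in>S. C i d" "C i e"
    by blast
  then have "\<forall>i\<in>insert i S. C i (max d e)"
    using mono by (auto intro: max.cobounded1 max.cobounded2)
  then show ?case by blast
qed simp

lemma pred_dvd_power_pred: "(x - 1 :: int) dvd x ^ d - 1"
proof (induction d)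
  case (Suc d)
  have "x ^ Suc d - 1 = x * (x ^ d - 1) + (x - 1)"
    by (simp add: algebra_simps)
  then show ?case
    using Suc by (metis dvd_add dvd_mult dvd_refl)
qed simp

text \<open>Modulo \<open>n - 1\<close> both \<open>n\<close> and \<open>n ^ d\<close> are
  \<open>1\<close>, so the equation says that \<open>p\<close> and \<open>q\<close> are congruent. A
  positive difference is then at least \<open>n - 1\<close>, and \<open>p \<ge> 1\<close> gives the
  bound.\<close>

lemma rank_bound:
  fixes n p q :: nat
  assumes "2 \<le> n" "1 \<le> p" "p < q" and eq: "p + n * l = l + q * n ^ d"
  shows "n \<le> q"
proof -
  have "int q - int p = (int n - 1) * int l - int q * (int n ^ d - 1)"
    using arg_cong[OF eq, of int] by (simp add: algebra_simps)
  then have "(int n - 1) dvd int q - int p"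
    using pred_dvd_power_pred[of "int n" d] by simp
  then have "int n - 1 \<le> int q - int p"
    using \<open>p < q\<close> by (intro zdvd_imp_le) auto
  with assms(2) show ?thesis
    by simp
qed

text \<open>A row of \<open>p\<close> vectors times a \<open>p \<times> q\<close> matrix, with zeros
  from index \<open>q\<close> on so that the result lies in \<open>vecs q\<close>. As the algebra
  acts on the right, applying \<open>P\<close> and then \<open>Q\<close> is the action of the
  product matrix \<open>P Q\<close>.\<close>

definition mat_act ::
    "nat \<Rightarrow> nat \<Rightarrow> (nat \<Rightarrow> nat \<Rightarrow> (('x, 'k) nc_series + 'x, 'k :: comm_ring_1) nc_series)
      \<Rightarrow> (nat \<Rightarrow> ('x, 'k) words) \<Rightarrow> nat \<Rightarrow> ('x, 'k) words"
  where "mat_act p q P u = (\<lambda>j. if j < q then \<Sum>i<p. act (P i j) (u i) else 0)"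

lemma vecs_short_iff: "u \<in> vecs p {w. length w < d} \<longleftrightarrow> (\<forall>i. u i \<in> short d) \<and> (\<forall>i\<ge>p. u i = 0)"
  by (simp add: vecs_def short_def)

lemma linear_mat_act:
  fixes P :: "nat \<Rightarrow> nat \<Rightarrow> (('x, 'k) nc_series + 'x, 'k :: comm_ring_1) nc_series"
  shows "Vector_Spaces.linear vscale vscale (mat_act p q P)"
proof -
  interpret A: Vector_Spaces.linear pscale pscale "act f" for f :: "(('x, 'k) nc_series + 'x, 'k) nc_series"
    by (rule plinear_act)
  show ?thesis
    by (auto simp: linear_iff vec.vector_space_axioms mat_act_def fun_eq_iff vscale_def
        A.add A.scale sum.distrib pvec.scale_sum_right)
qed

lemma mat_act_in_vecs: "mat_act p q P u \<in> vecs q UNIV"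
  by (simp add: vecs_def mat_act_def)

lemma mat_act_mat_act:
  fixes P Q :: "nat \<Rightarrow> nat \<Rightarrow> (('x, 'k) nc_series + 'x, 'k :: comm_ring_1) nc_series"
  assumes P: "\<And>i j. P i j \<in> nc_polys X" and Q: "\<And>i j. Q i j \<in> nc_polys X" and "k < r"
  shows "mat_act q r Q (mat_act p q P u) k = (\<Sum>i<p. act (\<Sum>j<q. P i j * Q j k) (u i))"
proof -
  interpret A: Vector_Spaces.linear pscale pscale "act f" for f :: "(('x, 'k) nc_series + 'x, 'k) nc_series"
    by (rule plinear_act)
  have "mat_act q r Q (mat_act p q P u) k = (\<Sum>j<q. \<Sum>i<p. act (P i j * Q j k) (u i))"
    using \<open>k < r\<close> by (simp add: mat_act_def A.sum act_mult[OF P Q])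
  also have "\<dots> = (\<Sum>i<p. \<Sum>j<q. act (P i j * Q j k) (u i))"
    by (rule sum.swap)
  also have "\<dots> = (\<Sum>i<p. act (\<Sum>j<q. P i j * Q j k) (u i))"
    using P Q by (simp add: act_sum[of _ _ X] nc_polys_mult)
  finally show ?thesis .
qed

text \<open>The defect of the composite is the action of the matrix \<open>P Q - 1\<close>, whose
  finitely many entries have bounded operators with a common bound.\<close>

lemma mat_act_inverse_bounded:
  assumes P: "\<And>i j. P i j \<in> nc_polys X" and Q: "\<And>i j. Q i j \<in> nc_polys X"
    and PQ: "\<And>i k. i < p \<Longrightarrow> k < p \<Longrightarrow> bounded_act ((\<Sum>j<q. P i j * Q j k) - (if i = k then 1 else 0))"
  shows "\<exists>d. \<forall>u\<in>vecs p UNIV. mat_act q p Q (mat_act p q P u) - u \<in> vecs p {w. length w < d}"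
proof -
  let ?D = "\<lambda>i k. (\<Sum>j<q. P i j * Q j k) - (if i = k then 1 else 0)"
  have "\<exists>d. \<forall>x\<in>{..<p} \<times> {..<p}. \<forall>v. act (?D (fst x) (snd x)) v \<in> short d"
  proof (rule uniform_bound)
    fix x assume "x \<in> {..<p} \<times> {..<p}"
    then show "\<exists>d. \<forall>v. act (?D (fst x) (snd x)) v \<in> short d"
      using PQ[of "fst x" "snd x"] by (auto simp: bounded_act_def)
  qed (simp, meson short_mono)
  then obtain d where d: "\<And>i k v. i < p \<Longrightarrow> k < p \<Longrightarrow> act (?D i k) v \<in> short d"
    by auto
  have D: "act (?D i k) v = act (\<Sum>j<q. P i j * Q j k) v - act (if i = k then 1 else 0) v" for i k v
    by (rule act_diff[of _ X _ X])
      (auto intro!: sum_in_polys nc_polys_mult P Q simp: nc_polys_0 nc_polys_1)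
  have "mat_act q p Q (mat_act p q P u) - u \<in> vecs p {w. length w < d}" if u: "u \<in> vecs p UNIV" for u
    unfolding vecs_short_iff
  proof (intro conjI allI impI)
    fix k
    show "(mat_act q p Q (mat_act p q P u) - u) k \<in> short d"
    proof (cases "k < p")
      case True
      have "u k = (\<Sum>i<p. act (if i = k then 1 else 0) (u i))"
      proof -
        have "(\<Sum>i<p. act (if i = k then 1 else 0) (u i)) = (\<Sum>i<p. if i = k then u i else 0)"
          by (intro sum.cong) auto
        with True show ?thesis by simp
      qed
      then have "(mat_act q p Q (mat_act p q P u) - u) k
          = (\<Sum>i<p. act (\<Sum>j<q. P i j * Q j k) (u i)) - (\<Sum>i<p. act (if i = k then 1 else 0) (u i))"
        by (simp add: mat_act_mat_act[OF P Q True])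
      also have "\<dots> = (\<Sum>i<p. act (?D i k) (u i))"
        unfolding sum_subtractf[symmetric] D ..
      also have "\<dots> \<in> short d"
        using d True by (intro short_sum) auto
      finally show ?thesis .
    next
      case False
      with u show ?thesis
        by (simp add: vecs_def mat_act_def short_iff)
    qed
    show "(mat_act q p Q (mat_act p q P u) - u) k = 0" if "p \<le> k"
      using that u by (simp add: vecs_def mat_act_def)
  qed
  then show ?thesis by blast
qed

lemma mat_act_short:
  assumes P: "\<And>i j. P i j \<in> nc_polys X"
  shows "\<exists>e. \<forall>u\<in>vecs p {w. length w < d}. mat_act p q P u \<in> vecs q {w. length w < e}"
proof -
  have "\<exists>e. \<forall>x\<in>{..<p} \<times> {..<q}. \<forall>v\<in>short d. act (P (fst x) (snd x)) v \<in> short e"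
  proof (rule uniform_bound)
    fix x :: "nat \<times> nat"
    show "\<exists>e. \<forall>v\<in>short d. act (P (fst x) (snd x)) v \<in> short e"
      using act_short[OF P] by metis
  qed (simp, meson short_mono)
  then obtain e where e: "\<And>i j v. i < p \<Longrightarrow> j < q \<Longrightarrow> v \<in> short d \<Longrightarrow> act (P i j) v \<in> short e"
    by auto
  then have "mat_act p q P u \<in> vecs q {w. length w < e}" if "u \<in> vecs p {w. length w < d}" for u
    using that unfolding vecs_short_iff mat_act_def
    by (auto intro!: short_sum e) (simp add: short_iff)
  then show ?thesis by blast
qed

lemma mat_act_vderiv:
  fixes P :: "nat \<Rightarrow> nat \<Rightarrow> (('x, 'k) nc_series + 'x, 'k :: comm_ring_1) nc_series"
  assumes P: "\<And>i j. P i j \<in> nc_polys X"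
  shows "\<exists>d. \<forall>l u. vderiv l (mat_act p q P u) - mat_act p q P (vderiv l u) \<in> vecs q {w. length w < d}"
proof -
  have "\<exists>d. \<forall>x\<in>{..<p} \<times> {..<q}. \<forall>l v. deriv_last l (act (P (fst x) (snd x)) v) - act (P (fst x) (snd x)) (deriv_last l v) \<in> short d"
  proof (rule uniform_bound)
    fix x :: "nat \<times> nat"
    show "\<exists>d. \<forall>l v. deriv_last l (act (P (fst x) (snd x)) v) - act (P (fst x) (snd x)) (deriv_last l v) \<in> short d"
      using deriv_last_act[OF P] by metis
  qed (simp, meson short_mono)
  then obtain d where d: "\<And>i j l v. i < p \<Longrightarrow> j < q
      \<Longrightarrow> deriv_last l (act (P i j) v) - act (P i j) (deriv_last l v) \<in> short d"
    by (metis SigmaI fst_conv lessThan_iff snd_conv)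
  interpret D: Vector_Spaces.linear pscale pscale "deriv_last l :: ('x, 'k) words \<Rightarrow> _" for l
    by (rule plinear_deriv_last)
  have "vderiv l (mat_act p q P u) - mat_act p q P (vderiv l u) \<in> vecs q {w. length w < d}" for l u
    unfolding vecs_short_iff
  proof (intro conjI allI impI)
    fix j
    show "(vderiv l (mat_act p q P u) - mat_act p q P (vderiv l u)) j = 0" if "q \<le> j"
      using that by (simp add: mat_act_def D.zero)
    have "(vderiv l (mat_act p q P u) - mat_act p q P (vderiv l u)) j
      = (if j < q then \<Sum>i<p. deriv_last l (act (P i j) (u i)) - act (P i j) (deriv_last l (u i)) else 0)"
      by (simp add: mat_act_def D.zero D.sum sum_subtractf)
    also have "\<dots> \<in> short d"
      using d by (auto intro!: short_sum) (simp add: short_iff)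
    finally show "(vderiv l (mat_act p q P u) - mat_act p q P (vderiv l u)) j \<in> short d" .
  qed
  then show ?thesis by blast
qed

lemma matrix_index:
  fixes P Q :: "nat \<Rightarrow> nat \<Rightarrow> (('x :: finite, 'k) nc_series + 'x, 'k :: comm_ring_1) nc_series"
  assumes P: "\<And>i j. P i j \<in> nc_polys X" and Q: "\<And>i j. Q i j \<in> nc_polys X"
    and PQ: "\<And>i k. i < p \<Longrightarrow> k < p \<Longrightarrow> bounded_act ((\<Sum>j<q. P i j * Q j k) - (if i = k then 1 else 0))"
    and QP: "\<And>i k. i < q \<Longrightarrow> k < q \<Longrightarrow> bounded_act ((\<Sum>j<p. Q i j * P j k) - (if i = k then 1 else 0))"
  shows "\<exists>l d. p + CARD('x) * l = l + q * CARD('x) ^ d"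
proof -
  let ?A = "mat_act p q P" and ?B = "mat_act q p Q"
  obtain d1 where d1: "\<And>u. u \<in> vecs p UNIV \<Longrightarrow> ?B (?A u) - u \<in> vecs p {w. length w < d1}"
    using mat_act_inverse_bounded[OF P Q PQ] by blast
  obtain d2 where d2: "\<And>u. u \<in> vecs q UNIV \<Longrightarrow> ?A (?B u) - u \<in> vecs q {w. length w < d2}"
    using mat_act_inverse_bounded[OF Q P QP] by blast
  obtain d3 where d3: "\<And>l u. vderiv l (?A u) - ?A (vderiv l u) \<in> vecs q {w. length w < d3}"
    using mat_act_vderiv[where P = P and p = p and q = q, OF P] by blast
  \<comment> \<open>The index formula wants one bound for both inverse errors and the commutator;
    the sum dominates all three. The bound \<open>e\<close> for \<open>?B\<close> is obtained
    afterwards because it depends on \<open>d\<close>.\<close>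
  define d where "d = d1 + d2 + d3"
  have mono: "u \<in> vecs r {w. length w < d}" if "u \<in> vecs r {w. length w < m}" "m \<le> d"
    for u :: "nat \<Rightarrow> ('x, 'k) words" and m r
    using that vecs_mono[of "{w :: 'x list. length w < m}" "{w. length w < d}" r] by fastforce
  obtain e where "\<forall>u\<in>vecs q {w. length w < d}. ?B u \<in> vecs p {w. length w < e}"
    using mat_act_short[where P = Q and p = q and q = p and d = d, OF Q] by blast
  then have "\<exists>l. p + CARD('x) * l = l + q * CARD('x) ^ d"
    by (intro index_formula[of ?A q ?B p d e] linear_mat_act mat_act_in_vecs mono[OF d1] mono[OF d2] mono[OF d3])
      (auto simp: d_def)
  then show ?thesis by blast
qed

text \<open>The common interface through which the rational and the algebraic closure are treated at
  once.\<close>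

locale leavitt_base =
  fixes R :: "('x :: finite, 'k :: comm_ring_1) nc_series set"
  assumes subalgebra: "nc_subalgebra R" and var_in: "nc_var x \<in> R"
begin

lemma base_gen_poly: "r \<in> R \<Longrightarrow> base_gen r \<in> leavitt_polys R"
  by (rule nc_var_poly) (simp add: leavitt_gens_def)

lemma star_gen_poly: "star_gen i \<in> leavitt_polys R"
  by (rule nc_var_poly) (simp add: leavitt_gens_def)

lemma diff_poly: "a \<in> leavitt_polys R \<Longrightarrow> b \<in> leavitt_polys R \<Longrightarrow> a - b \<in> leavitt_polys R"
  using nc_polys_add[OF _ nc_polys_uminus] by fastforce

lemma closed_R: "r \<in> R \<Longrightarrow> s \<in> R \<Longrightarrow> r + s \<in> R" "r \<in> R \<Longrightarrow> s \<in> R \<Longrightarrow> r * s \<in> R" "nc_const c \<in> R"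
  using subalgebra by (auto simp: nc_subalgebra_def)

text \<open>Four of the five families of relations hold exactly for the action. The relation for the
  sum over all variables fails only at the empty word.\<close>

lemma relations_poly_bounded:
  assumes "f \<in> leavitt_relations R"
  shows "f \<in> leavitt_polys R \<and> bounded_act f"
proof -
  note poly = base_gen_poly star_gen_poly diff_poly nc_polys_add nc_polys_mult nc_const_poly
    nc_polys_0 nc_polys_1 closed_R var_in sum_in_polys
  have zero: "bounded_act f" if "\<And>v. act f v = 0" for f :: "(('x, 'k) nc_series + 'x, 'k) nc_series"
    using that by (simp add: bounded_act_def short_iff)
  note d = act_diff[where X = "leavitt_gens R" and Y = "leavitt_gens R"]
  note a = act_add[where X = "leavitt_gens R" and Y = "leavitt_gens R"]
  note m = act_mult[where X = "leavitt_gens R" and Y = "leavitt_gens R"]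
  consider
      (add) r s where "r \<in> R" "s \<in> R" "f = base_gen (r + s) - (base_gen r + base_gen s)"
    | (mult) r s where "r \<in> R" "s \<in> R" "f = base_gen (r * s) - base_gen r * base_gen s"
    | (const) c where "f = base_gen (nc_const c) - nc_const c"
    | (orth) i j where "f = star_gen i * base_gen (nc_var j) - (if i = j then 1 else 0)"
    | (complete) "f = (\<Sum>i\<in>UNIV. base_gen (nc_var i) * star_gen i) - 1"
    using assms unfolding leavitt_relations_def by blast
  then show ?thesis
  proof cases
    case add
    then have "f \<in> leavitt_polys R"
      by (simp add: poly)
    moreover have "act f v = 0" for v
      using add by (simp add: d a poly gen_act_def base_act_add)
    ultimately show ?thesis
      using zero by blast
  next
    case mult
    then have "f \<in> leavitt_polys R"
      by (simp add: poly)
    moreover have "act f v = 0" for v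
      using mult by (simp add: d m poly gen_act_def base_act_mult)
    ultimately show ?thesis
      using zero by blast
  next
    case const
    then have "f \<in> leavitt_polys R"
      by (simp add: poly)
    moreover have "act f v = 0" for v
      using const by (simp add: d poly gen_act_def base_act_const)
    ultimately show ?thesis
      using zero by blast
  next
    case orth
    then have "f \<in> leavitt_polys R"
      by (simp add: poly)
    moreover have "act f v = 0" for v
      using orth by (simp add: d m poly gen_act_def base_var_star)
    ultimately show ?thesis
      using zero by blast
  next
    case complete
    have sum_poly: "(\<Sum>i\<in>UNIV. base_gen (nc_var i) * star_gen i) \<in> leavitt_polys R"
      by (intro sum_in_polys nc_polys_mult base_gen_poly star_gen_poly var_in)
    with complete have "f \<in> leavitt_polys R"
      by (simp add: diff_poly nc_polys_1)
    have act_f: "act f v = (\<Sum>i\<in>UNIV. star_act i (base_act (nc_var i) v)) - v" for v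
    proof -
      have "act f v = act (\<Sum>i\<in>UNIV. base_gen (nc_var i) * star_gen i) v - act 1 v"
        unfolding complete by (rule d[OF sum_poly nc_polys_1])
      also have "act (\<Sum>i\<in>UNIV. base_gen (nc_var i) * star_gen i) v
          = (\<Sum>i\<in>UNIV. act (base_gen (nc_var i) * star_gen i) v)"
        by (rule act_sum[where X = "leavitt_gens R"]) (intro nc_polys_mult base_gen_poly star_gen_poly var_in)
      finally show ?thesis
        by (simp add: m base_gen_poly star_gen_poly var_in gen_act_def)
    qed
    have "bounded_act f"
      unfolding bounded_act_def act_f using sum_star_base_var by blast
    with \<open>f \<in> leavitt_polys R\<close> show ?thesis by blast
  qed
qed

sublocale F: ring "leavitt_ring R"
  by (rule ring_nc_poly_ring)

lemma relations_poly: "leavitt_relations R \<subseteq> carrier (leavitt_ring R)"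
  using relations_poly_bounded by auto

sublocale I: ideal "leavitt_ideal R" "leavitt_ring R"
  unfolding leavitt_ideal_def by (rule F.genideal_ideal[OF relations_poly])

lemma relations_in_ideal: "leavitt_relations R \<subseteq> leavitt_ideal R"
  unfolding leavitt_ideal_def by (rule F.genideal_self[OF relations_poly])

text \<open>The polynomials with bounded operator form an ideal containing the relations, hence the
  ideal generated by them. This is how an identity in the localization becomes a statement about
  operators.\<close>

lemma ideal_bounded: "f \<in> leavitt_ideal R \<Longrightarrow> bounded_act f"
  using F.genideal_minimal[OF ideal_bounded_act, of "leavitt_relations R"] relations_poly_bounded
  unfolding leavitt_ideal_def by blast

abbreviation (input) T where "T \<equiv> leavitt_localization R"
abbreviation (input) h where "h \<equiv> leavitt_class R"
abbreviation (input) I where "I \<equiv> leavitt_ideal R"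

lemma ring_T: "ring T"
  unfolding leavitt_localization_eq by (rule I.quotient_is_ring)

lemma
  assumes "a \<in> leavitt_polys R" "b \<in> leavitt_polys R"
  shows h_add: "h a \<oplus>\<^bsub>T\<^esub> h b = h (a + b)" and h_mult: "h a \<otimes>\<^bsub>T\<^esub> h b = h (a * b)"
    and h_eq_iff: "h a = h b \<longleftrightarrow> a - b \<in> I"
proof -
  note hom = I.rcos_ring_hom[folded leavitt_localization_eq leavitt_class_def]
  show "h a \<oplus>\<^bsub>T\<^esub> h b = h (a + b)" "h a \<otimes>\<^bsub>T\<^esub> h b = h (a * b)"
    using ring_hom_add[OF hom, of a b] ring_hom_mult[OF hom, of a b] assms
    by (simp_all add: leavitt_class_def)
  show "h a = h b \<longleftrightarrow> a - b \<in> I"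
    using F.quotient_eq_iff_same_a_r_cos[OF I.is_ideal, of a b] assms
    by (simp add: leavitt_class_def nc_poly_ring_minus)
qed

lemma h_carrier: "a \<in> leavitt_polys R \<Longrightarrow> h a \<in> carrier T"
  unfolding leavitt_localization_eq leavitt_class_def
  by (auto simp: FactRing_def A_RCOSETS_def')

lemma h_surj: "t \<in> carrier T \<Longrightarrow> \<exists>a\<in>leavitt_polys R. t = h a"
  unfolding leavitt_localization_eq leavitt_class_def
  by (auto simp: FactRing_def A_RCOSETS_def')

lemma I_poly: "a \<in> I \<Longrightarrow> a \<in> leavitt_polys R"
  using I.a_subset by auto

lemma I_0: "0 \<in> I"
  using I.zero_closed by simp

lemma I_add: "a \<in> I \<Longrightarrow> b \<in> I \<Longrightarrow> a + b \<in> I"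
  using I.a_closed by simp

lemma I_uminus: "a \<in> I \<Longrightarrow> - a \<in> I"
  using I.a_inv_closed[of a] I_poly[of a] by (simp add: nc_poly_ring_uminus)

lemma I_diff: "a \<in> I \<Longrightarrow> b \<in> I \<Longrightarrow> a - b \<in> I"
  using I_add[OF _ I_uminus] by fastforce

lemma I_lmult: "a \<in> I \<Longrightarrow> b \<in> leavitt_polys R \<Longrightarrow> b * a \<in> I"
  using I.I_l_closed by simp

lemma I_rmult: "a \<in> I \<Longrightarrow> b \<in> leavitt_polys R \<Longrightarrow> a * b \<in> I"
  using I.I_r_closed by simp

lemma I_sum: "(\<And>i. i \<in> S \<Longrightarrow> f i \<in> I) \<Longrightarrow> (\<Sum>i\<in>S. f i) \<in> I"
  by (induction S rule: infinite_finite_induct) (simp_all add: I_0 I_add)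

text \<open>Otherwise \<open>1\<close> would lie in the Leavitt ideal and the identity operator
  would have bounded values, although there are words of every length.\<close>

lemma one_neq_zero_T: "\<one>\<^bsub>T\<^esub> \<noteq> \<zero>\<^bsub>T\<^esub>"
proof
  have one: "\<one>\<^bsub>T\<^esub> = h 1" and zero: "\<zero>\<^bsub>T\<^esub> = I"
    by (simp_all add: leavitt_localization_eq leavitt_class_def FactRing_def)
  assume "\<one>\<^bsub>T\<^esub> = \<zero>\<^bsub>T\<^esub>"
  then have "1 \<in> I"
    using I.a_rcos_self[of 1] unfolding one zero leavitt_class_def by (simp add: nc_polys_1)
  from ideal_bounded[OF this] obtain d where "\<And>v :: ('x, 'k) words. v \<in> short d"
    unfolding bounded_act_def by auto
  \<comment> \<open>This word has length exactly \<open>d\<close> and so just violates the strict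
    bound; the letter is arbitrary.\<close>
  then have "Poly_Mapping.single (replicate d undefined) 1 \<in> (short d :: ('x, 'k) words set)"
    by blast
  then show False
    by (auto simp: short_iff lookup_single when_def split: if_splits)
qed

section \<open>Free modules over the localization through polynomial representatives\<close>

definition vec_class :: "nat \<Rightarrow> (nat \<Rightarrow> (('x, 'k) nc_series + 'x, 'k) nc_series)
    \<Rightarrow> nat \<Rightarrow> (('x, 'k) nc_series + 'x, 'k) nc_series set"
  where "vec_class p a = (\<lambda>i\<in>{..<p}. h (a i))"

abbreviation (input) M where "M p \<equiv> free_left_module T p"

lemma vec_class_carrier: "(\<And>i. i < p \<Longrightarrow> a i \<in> leavitt_polys R) \<Longrightarrow> vec_class p a \<in> carrier (M p)"
  by (simp add: vec_class_def free_left_module_def h_carrier)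

lemma vec_class_surj:
  assumes "u \<in> carrier (M p)"
  shows "\<exists>a. (\<forall>i. a i \<in> leavitt_polys R) \<and> u = vec_class p a"
proof -
  have "\<forall>i. \<exists>a. a \<in> leavitt_polys R \<and> (i < p \<longrightarrow> u i = h a)"
  proof
    fix i
    show "\<exists>a. a \<in> leavitt_polys R \<and> (i < p \<longrightarrow> u i = h a)"
    proof (cases "i < p")
      case True
      with assms have "u i \<in> carrier T"
        by (auto simp: free_left_module_def)
      from h_surj[OF this] show ?thesis by blast
    qed (use nc_polys_0 in blast)
  qed
  from choice[OF this] obtain a where a: "\<And>i. a i \<in> leavitt_polys R" "\<And>i. i < p \<Longrightarrow> u i = h (a i)"
    by blast
  have "u = vec_class p a"
    using assms a(2) by (auto simp: free_left_module_def vec_class_def PiE_iff extensional_def fun_eq_iff)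
  with a(1) show ?thesis by blast
qed

lemma vec_class_eq_iff:
  assumes "\<And>i. i < p \<Longrightarrow> a i \<in> leavitt_polys R" "\<And>i. i < p \<Longrightarrow> b i \<in> leavitt_polys R"
  shows "vec_class p a = vec_class p b \<longleftrightarrow> (\<forall>i<p. a i - b i \<in> I)"
proof -
  have "vec_class p a = vec_class p b \<longleftrightarrow> (\<forall>i<p. h (a i) = h (b i))"
    by (auto simp: vec_class_def fun_eq_iff restrict_def)
  then show ?thesis
    using assms h_eq_iff by simp
qed

lemma vec_class_add:
  assumes "\<And>i. i < p \<Longrightarrow> a i \<in> leavitt_polys R" "\<And>i. i < p \<Longrightarrow> b i \<in> leavitt_polys R"
  shows "vec_class p a \<oplus>\<^bsub>M p\<^esub> vec_class p b = vec_class p (\<lambda>i. a i + b i)"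
  using assms by (auto simp: free_left_module_def vec_class_def restrict_def fun_eq_iff h_add)

lemma vec_class_smult:
  assumes "c \<in> leavitt_polys R" "\<And>i. i < p \<Longrightarrow> b i \<in> leavitt_polys R"
  shows "h c \<odot>\<^bsub>M p\<^esub> vec_class p b = vec_class p (\<lambda>i. c * b i)"
  using assms by (auto simp: free_left_module_def vec_class_def restrict_def fun_eq_iff h_mult)

lemma vec_class_cong: "(\<And>i. i < p \<Longrightarrow> a i = b i) \<Longrightarrow> vec_class p a = vec_class p b"
  by (auto simp: vec_class_def intro!: restrict_ext)

text \<open>Row \<open>k\<close> of the matrix consists of polynomials representing the image of the
  \<open>k\<close>-th unit vector. A homomorphism of left modules is then multiplication of rows by
  this matrix from the right.\<close>

lemma module_hom_matrix:
  assumes maps: "\<And>u. u \<in> carrier (M p) \<Longrightarrow> \<phi> u \<in> carrier (M q)"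
    and add: "\<And>u v. u \<in> carrier (M p) \<Longrightarrow> v \<in> carrier (M p) \<Longrightarrow> \<phi> (u \<oplus>\<^bsub>M p\<^esub> v) = \<phi> u \<oplus>\<^bsub>M q\<^esub> \<phi> v"
    and smult: "\<And>t v. t \<in> carrier T \<Longrightarrow> v \<in> carrier (M p) \<Longrightarrow> \<phi> (t \<odot>\<^bsub>M p\<^esub> v) = t \<odot>\<^bsub>M q\<^esub> \<phi> v"
  shows "\<exists>P. (\<forall>i j. P i j \<in> leavitt_polys R) \<and> (\<forall>a. (\<forall>i. a i \<in> leavitt_polys R) \<longrightarrow>
    \<phi> (vec_class p a) = vec_class q (\<lambda>j. \<Sum>i<p. a i * P i j))"
proof -
  define e :: "nat \<Rightarrow> nat \<Rightarrow> (('x, 'k) nc_series + 'x, 'k) nc_series"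
    where "e k = (\<lambda>i. if i = k then 1 else 0)" for k
  have e: "e k i \<in> leavitt_polys R" for k i
    by (simp add: e_def nc_polys_0 nc_polys_1)
  have "\<forall>k. \<exists>b. (\<forall>j. b j \<in> leavitt_polys R) \<and> \<phi> (vec_class p (e k)) = vec_class q b"
    using vec_class_surj[OF maps[OF vec_class_carrier]] e by blast
  from choice[OF this] obtain P where P: "\<And>i j. P i j \<in> leavitt_polys R"
    "\<And>k. \<phi> (vec_class p (e k)) = vec_class q (P k)"
    by blast
  have "\<phi> (vec_class p a) = vec_class q (\<lambda>j. \<Sum>i<p. a i * P i j)" if a: "\<And>i. a i \<in> leavitt_polys R" for a
  proof -
    have trunc: "(if i < m then a i else 0) \<in> leavitt_polys R" for i m
      using a by (simp add: nc_polys_0)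
    have sum: "(\<Sum>i<m. a i * P i j) \<in> leavitt_polys R" for m j
      by (intro sum_in_polys nc_polys_mult a P)
    \<comment> \<open>Additivity covers two summands only, so the coordinates are switched on one by
      one.\<close>
    have "\<phi> (vec_class p (\<lambda>i. if i < m then a i else 0)) = vec_class q (\<lambda>j. \<Sum>i<m. a i * P i j)" for m
    proof (induction m)
      case 0
      \<comment> \<open>Preservation of zero is not among the assumptions; it follows by writing the
        zero vector as a zero multiple.\<close>
      have "\<phi> (vec_class p (\<lambda>i. 0)) = \<phi> (h 0 \<odot>\<^bsub>M p\<^esub> vec_class p (e 0))"
        using vec_class_smult[of 0 p "e 0"] e by (simp add: nc_polys_0)
      also have "\<dots> = h 0 \<odot>\<^bsub>M q\<^esub> vec_class q (P 0)"
        using smult[OF h_carrier vec_class_carrier] e P(2) by (simp add: nc_polys_0)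
      also have "\<dots> = vec_class q (\<lambda>j. 0)"
        using vec_class_smult[of 0 q "P 0"] P(1) by (simp add: nc_polys_0)
      finally show ?case by simp
    next
      case (Suc m)
      have "vec_class p (\<lambda>i. if i < Suc m then a i else 0)
          = vec_class p (\<lambda>i. (if i < m then a i else 0) + a m * e m i)"
        by (rule vec_class_cong) (auto simp: e_def less_Suc_eq)
      also have "\<dots> = vec_class p (\<lambda>i. if i < m then a i else 0) \<oplus>\<^bsub>M p\<^esub> (h (a m) \<odot>\<^bsub>M p\<^esub> vec_class p (e m))"
        using vec_class_add[of p "\<lambda>i. if i < m then a i else 0" "\<lambda>i. a m * e m i"]
          vec_class_smult[of "a m" p "e m"] trunc a e by (simp add: nc_polys_mult)
      finally have split: "vec_class p (\<lambda>i. if i < Suc m then a i else 0)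
        = vec_class p (\<lambda>i. if i < m then a i else 0) \<oplus>\<^bsub>M p\<^esub> (h (a m) \<odot>\<^bsub>M p\<^esub> vec_class p (e m))" .
      have smult_carrier: "h (a m) \<odot>\<^bsub>M p\<^esub> vec_class p (e m) \<in> carrier (M p)"
        using vec_class_smult[of "a m" p "e m"] vec_class_carrier[of p "\<lambda>i. a m * e m i"] a e
        by (simp add: nc_polys_mult)
      have "\<phi> (vec_class p (\<lambda>i. if i < Suc m then a i else 0))
          = vec_class q (\<lambda>j. \<Sum>i<m. a i * P i j) \<oplus>\<^bsub>M q\<^esub> (h (a m) \<odot>\<^bsub>M q\<^esub> vec_class q (P m))"
        unfolding split
        using add[OF vec_class_carrier smult_carrier] trunc Suc.IH
          smult[OF h_carrier vec_class_carrier] a e P(2) by simp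
      also have "\<dots> = vec_class q (\<lambda>j. \<Sum>i<Suc m. a i * P i j)"
        using vec_class_add[of q "\<lambda>j. \<Sum>i<m. a i * P i j" "\<lambda>j. a m * P m j"]
          vec_class_smult[of "a m" q "P m"] a P(1) sum by (simp add: nc_polys_mult)
      finally show ?case .
    qed
    from this[of p] show ?thesis
      using vec_class_cong[of p "\<lambda>i. if i < p then a i else 0" a] by simp
  qed
  with P(1) show ?thesis by blast
qed

text \<open>The \<open>i\<close>-th unit vector goes to row \<open>i\<close> of \<open>P\<close> and
  then to row \<open>i\<close> of \<open>P Q\<close>, which must represent the unit vector again.
  The entries of \<open>P Q - 1\<close> thus lie in the Leavitt ideal.\<close>

lemma inverse_matrices:
  assumes P: "\<And>i j. P i j \<in> leavitt_polys R"
    and Q: "\<And>i j. Q i j \<in> leavitt_polys R"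
    and \<phi>: "\<And>a. (\<And>i. a i \<in> leavitt_polys R) \<Longrightarrow> \<phi> (vec_class p a) = vec_class q (\<lambda>j. \<Sum>i<p. a i * P i j)"
    and \<psi>: "\<And>a. (\<And>i. a i \<in> leavitt_polys R) \<Longrightarrow> \<psi> (vec_class q a) = vec_class p (\<lambda>j. \<Sum>i<q. a i * Q i j)"
    and inv: "\<And>u. u \<in> carrier (M p) \<Longrightarrow> \<psi> (\<phi> u) = u"
    and i: "i < p" and k: "k < p"
  shows "bounded_act ((\<Sum>j<q. P i j * Q j k) - (if i = k then 1 else 0))"
proof -
  define e :: "nat \<Rightarrow> (('x, 'k) nc_series + 'x, 'k) nc_series"
    where "e = (\<lambda>k. if i = k then 1 else 0)"
  have e: "e l \<in> leavitt_polys R" for l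
    by (simp add: e_def nc_polys_0 nc_polys_1)
  have eP: "(\<Sum>l<p. e l * P l j) = P i j" for j
  proof -
    have "(\<Sum>l<p. e l * P l j) = (\<Sum>l<p. if l = i then P i j else 0)"
      by (intro sum.cong) (auto simp: e_def)
    with i show ?thesis by simp
  qed
  have "vec_class p e = \<psi> (\<phi> (vec_class p e))"
    using inv[OF vec_class_carrier] e by simp
  also have "\<dots> = vec_class p (\<lambda>k. \<Sum>j<q. P i j * Q j k)"
    using \<phi>[of e] \<psi>[of "P i"] e P by (simp add: eP)
  finally have "vec_class p (\<lambda>k. \<Sum>j<q. P i j * Q j k) = vec_class p e" ..
  then have "(\<Sum>j<q. P i j * Q j k) - e k \<in> I"
    using vec_class_eq_iff[of p "\<lambda>k. \<Sum>j<q. P i j * Q j k" e] e k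
    by (simp add: sum_in_polys nc_polys_mult P Q)
  from ideal_bounded[OF this] show ?thesis
    by (simp add: e_def)
qed

lemma free_ranks_index:
  assumes "free_ranks_isomorphic T p q"
  shows "\<exists>l d. p + CARD('x) * l = l + q * CARD('x) ^ d"
proof -
  interpret T: ring T
    by (rule ring_T)
  obtain \<phi> where bij: "bij_betw \<phi> (carrier (M p)) (carrier (M q))"
    and add: "\<And>u v. u \<in> carrier (M p) \<Longrightarrow> v \<in> carrier (M p) \<Longrightarrow> \<phi> (u \<oplus>\<^bsub>M p\<^esub> v) = \<phi> u \<oplus>\<^bsub>M q\<^esub> \<phi> v"
    and smult: "\<And>t v. t \<in> carrier T \<Longrightarrow> v \<in> carrier (M p) \<Longrightarrow> \<phi> (t \<odot>\<^bsub>M p\<^esub> v) = t \<odot>\<^bsub>M q\<^esub> \<phi> v"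
    using assms unfolding free_ranks_isomorphic_def left_modules_isomorphic_def by blast
  define \<psi> where "\<psi> = inv_into (carrier (M p)) \<phi>"
  have \<phi>: "\<phi> u \<in> carrier (M q)" "\<psi> (\<phi> u) = u" if "u \<in> carrier (M p)" for u
    using bij that unfolding \<psi>_def by (auto simp: bij_betw_def)
  have \<psi>: "\<psi> v \<in> carrier (M p)" "\<phi> (\<psi> v) = v" if "v \<in> carrier (M q)" for v
    using bij that unfolding \<psi>_def
    by (auto simp: bij_betw_def inv_into_into f_inv_into_f)
  have add_carrier: "u \<oplus>\<^bsub>M r\<^esub> v \<in> carrier (M r)" if "u \<in> carrier (M r)" "v \<in> carrier (M r)" for r u v
    using that by (auto simp: free_left_module_def PiE_iff)
  have smult_carrier: "t \<odot>\<^bsub>M r\<^esub> v \<in> carrier (M r)" if "t \<in> carrier T" "v \<in> carrier (M r)" for r t v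
    using that by (auto simp: free_left_module_def PiE_iff)
  obtain P where P: "\<And>i j. P i j \<in> leavitt_polys R"
    "\<And>a. (\<And>i. a i \<in> leavitt_polys R) \<Longrightarrow> \<phi> (vec_class p a) = vec_class q (\<lambda>j. \<Sum>i<p. a i * P i j)"
    using module_hom_matrix[of p \<phi> q, OF \<phi>(1) add smult] by blast
  have "\<psi> (u \<oplus>\<^bsub>M q\<^esub> v) = \<psi> u \<oplus>\<^bsub>M p\<^esub> \<psi> v" if "u \<in> carrier (M q)" "v \<in> carrier (M q)" for u v
    using add[OF \<psi>(1)[OF that(1)] \<psi>(1)[OF that(2)]] \<phi>(2)[OF add_carrier[OF \<psi>(1)[OF that(1)] \<psi>(1)[OF that(2)]]]
    by (simp add: \<psi>(2) that)
  moreover have "\<psi> (t \<odot>\<^bsub>M q\<^esub> v) = t \<odot>\<^bsub>M p\<^esub> \<psi> v" if "t \<in> carrier T" "v \<in> carrier (M q)" for t v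
    using smult[OF that(1) \<psi>(1)[OF that(2)]] \<phi>(2)[OF smult_carrier[OF that(1) \<psi>(1)[OF that(2)]]]
    by (simp add: \<psi>(2) that)
  ultimately obtain Q where Q: "\<And>i j. Q i j \<in> leavitt_polys R"
    "\<And>a. (\<And>i. a i \<in> leavitt_polys R) \<Longrightarrow> \<psi> (vec_class q a) = vec_class p (\<lambda>j. \<Sum>i<q. a i * Q i j)"
    using module_hom_matrix[of q \<psi> p, OF \<psi>(1)] by blast
  show ?thesis
    using matrix_index[of P "leavitt_gens R" Q p q, OF P(1) Q(1)
        inverse_matrices[of P Q \<phi> p q \<psi>, OF P(1) Q(1) P(2) Q(2) \<phi>(2)]
        inverse_matrices[of Q P \<psi> q p \<phi>, OF Q(1) P(1) Q(2) P(2) \<psi>(2)]] .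
qed

text \<open>Multiplication by the row of the variables is inverted by multiplication with the column
  of the starred generators. The sum relation gives injectivity, the orthogonality relations give
  surjectivity.\<close>

lemma free_ranks_1_n: "free_ranks_isomorphic T 1 CARD('x)"
proof -
  note [simp del] = One_nat_def
  let ?n = "CARD('x)"
  obtain b where "bij_betw b {0..<?n} (UNIV :: 'x set)"
    using ex_bij_betw_nat_finite[OF finite[of "UNIV :: 'x set"]] by blast
  then have b: "bij_betw b {..<?n} (UNIV :: 'x set)"
    by (simp add: lessThan_atLeast0)
  define X where "X j = base_gen (nc_var (b j) :: ('x, 'k) nc_series)" for j
  define S where "S j = (star_gen (b j) :: (('x, 'k) nc_series + 'x, 'k) nc_series)" for j
  have X: "X j \<in> leavitt_polys R" and S: "S j \<in> leavitt_polys R" for j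
    unfolding X_def S_def by (intro base_gen_poly star_gen_poly var_in)+
  have XS: "(\<Sum>j<?n. X j * S j) - 1 \<in> I"
  proof -
    have "(\<Sum>j<?n. X j * S j) = (\<Sum>i\<in>UNIV. base_gen (nc_var i) * star_gen i)"
      unfolding X_def S_def by (rule sum.reindex_bij_betw[OF b])
    moreover have "(\<Sum>i\<in>UNIV. base_gen (nc_var i) * star_gen i) - 1 \<in> leavitt_relations R"
      unfolding leavitt_relations_def by blast
    ultimately show ?thesis
      using relations_in_ideal by auto
  qed
  have SX: "S j * X k - (if j = k then 1 else 0) \<in> I" if "j < ?n" "k < ?n" for j k
  proof -
    have "(b j = b k) = (j = k)"
      using b that by (auto simp: bij_betw_def dest: inj_onD)
    moreover have "star_gen (b j) * base_gen (nc_var (b k)) - (if b j = b k then 1 else 0) \<in> leavitt_relations R"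
      unfolding leavitt_relations_def by blast
    ultimately show ?thesis
      using relations_in_ideal unfolding X_def S_def by auto
  qed
  define \<phi> where "\<phi> u = (\<lambda>j\<in>{..<?n}. u 0 \<otimes>\<^bsub>T\<^esub> h (X j))" for u :: "nat \<Rightarrow> _ set"
  have \<phi>: "\<phi> (vec_class 1 a) = vec_class ?n (\<lambda>j. a 0 * X j)" if "\<And>i. a i \<in> leavitt_polys R" for a
    using that X by (auto simp: \<phi>_def vec_class_def fun_eq_iff restrict_def h_mult)
  have aX: "a * X j \<in> leavitt_polys R" if "a \<in> leavitt_polys R" for a j
    using that X by (rule nc_polys_mult)
  have "inj_on \<phi> (carrier (M 1))"
  proof (rule inj_onI)
    fix u v assume "u \<in> carrier (M 1)" "v \<in> carrier (M 1)" and eq: "\<phi> u = \<phi> v"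
    then obtain a c where a: "\<And>i. a i \<in> leavitt_polys R" "u = vec_class 1 a"
      and c: "\<And>i. c i \<in> leavitt_polys R" "v = vec_class 1 c"
      using vec_class_surj by metis
    have "(a 0 - c 0) * X j \<in> I" if "j < ?n" for j
      using eq that vec_class_eq_iff[of ?n "\<lambda>j. a 0 * X j" "\<lambda>j. c 0 * X j"] a c
      by (simp add: \<phi> aX left_diff_distrib)
    \<comment> \<open>Multiplying by the starred generators and summing recovers
      \<open>a 0 - c 0\<close> modulo the ideal, by \<open>XS\<close>.\<close>
    then have "(\<Sum>j<?n. (a 0 - c 0) * X j * S j) \<in> I"
      by (intro I_sum) (simp add: I_rmult S)
    moreover have "(a 0 - c 0) * ((\<Sum>j<?n. X j * S j) - 1) \<in> I"
      using XS a c by (intro I_lmult diff_poly) auto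
    ultimately have "(\<Sum>j<?n. (a 0 - c 0) * X j * S j) - (a 0 - c 0) * ((\<Sum>j<?n. X j * S j) - 1) \<in> I"
      by (rule I_diff)
    then have "a 0 - c 0 \<in> I"
      by (simp add: sum_distrib_left mult.assoc right_diff_distrib)
    then show "u = v"
      using vec_class_eq_iff[of 1 a c] a c by simp
  qed
  moreover have "\<phi> ` carrier (M 1) = carrier (M ?n)"
  proof
    show "\<phi> ` carrier (M 1) \<subseteq> carrier (M ?n)"
    proof (rule image_subsetI)
      fix u assume "u \<in> carrier (M 1)"
      then obtain a where "\<And>i. a i \<in> leavitt_polys R" "u = vec_class 1 a"
        using vec_class_surj by blast
      then show "\<phi> u \<in> carrier (M ?n)"
        using vec_class_carrier[of ?n "\<lambda>j. a 0 * X j"] by (simp add: \<phi> aX)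
    qed
    show "carrier (M ?n) \<subseteq> \<phi> ` carrier (M 1)"
    proof
      fix v assume "v \<in> carrier (M ?n)"
      then obtain c where c: "\<And>i. c i \<in> leavitt_polys R" "v = vec_class ?n c"
        using vec_class_surj by blast
      \<comment> \<open>The row \<open>c\<close> times the column of starred generators; by
        \<open>SX\<close>, multiplying \<open>a\<close> by \<open>X k\<close> returns
        \<open>c k\<close> modulo the ideal.\<close>
      define a where "a = (\<Sum>j<?n. c j * S j)"
      have a: "a \<in> leavitt_polys R"
        unfolding a_def by (intro sum_in_polys nc_polys_mult c S)
      have "a * X k - c k \<in> I" if "k < ?n" for k
      proof -
        have "(\<Sum>j<?n. c j * (S j * X k - (if j = k then 1 else 0))) \<in> I"
          using SX that c by (intro I_sum I_lmult) auto
        also have "(\<Sum>j<?n. c j * (S j * X k - (if j = k then 1 else 0)))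
            = a * X k - (\<Sum>j<?n. if j = k then c j else 0)"
          unfolding a_def sum_distrib_right sum_subtractf[symmetric]
          by (intro sum.cong) (auto simp: right_diff_distrib mult.assoc)
        finally show ?thesis
          using that by simp
      qed
      then have "v = \<phi> (vec_class 1 (\<lambda>i. a))"
        using vec_class_eq_iff[of ?n "\<lambda>j. a * X j" c] a c by (simp add: \<phi> aX)
      then show "v \<in> \<phi> ` carrier (M 1)"
        using vec_class_carrier[of 1 "\<lambda>i. a"] a by blast
    qed
  qed
  moreover have "\<phi> (u \<oplus>\<^bsub>M 1\<^esub> v) = \<phi> u \<oplus>\<^bsub>M ?n\<^esub> \<phi> v" if "u \<in> carrier (M 1)" "v \<in> carrier (M 1)" for u v
  proof -
    from that obtain a c where a: "\<And>i. a i \<in> leavitt_polys R" "u = vec_class 1 a"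
      and c: "\<And>i. c i \<in> leavitt_polys R" "v = vec_class 1 c"
      using vec_class_surj by metis
    then show ?thesis
      by (simp add: vec_class_add \<phi> aX nc_polys_add distrib_right)
  qed
  moreover have "\<phi> (t \<odot>\<^bsub>M 1\<^esub> v) = t \<odot>\<^bsub>M ?n\<^esub> \<phi> v" if "t \<in> carrier T" "v \<in> carrier (M 1)" for t v
  proof -
    from that obtain s c where s: "s \<in> leavitt_polys R" "t = h s"
      and c: "\<And>i. c i \<in> leavitt_polys R" "v = vec_class 1 c"
      using vec_class_surj h_surj by metis
    then show ?thesis
      by (simp add: vec_class_smult \<phi> aX nc_polys_mult mult.assoc)
  qed
  ultimately show ?thesis
    unfolding free_ranks_isomorphic_def left_modules_isomorphic_def bij_betw_def by blast
qed

theorem module_type: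
  assumes "CARD('x) \<ge> 2"
  shows "has_module_type T 1 CARD('x)"
  unfolding has_module_type_def
  using assms ring_T one_neq_zero_T free_ranks_1_n
  by (auto dest!: free_ranks_index intro: rank_bound)

end

section \<open>The rational and the algebraic closure are subalgebras\<close>

lemma nc_subalgebra_rational_closure: "nc_subalgebra nc_rational_closure"
  unfolding nc_rational_closure_def nc_subalgebra_def by blast

lemma nc_var_rational_closure: "nc_var x \<in> nc_rational_closure"
  unfolding nc_rational_closure_def using nc_var_poly[of x UNIV] by blast

lemma nc_const_add: "nc_const (a + b) = nc_const a + nc_const b"
  by (rule nc_series_eqI) (simp add: nc_coeff_const)

lemma nc_const_mult: "nc_const (a * b) = nc_const a * nc_const b"
  by (rule nc_series_eqI) (simp add: nc_coeff_const)

lemma nc_const_commute: "f * nc_const (c :: 'k :: comm_ring_1) = nc_const c * f"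
  by (rule nc_series_eqI) (simp add: mult.commute)

lemma nc_const_mult_mult:
  "nc_const (a * b) * (f * g) = nc_const a * f * (nc_const (b :: 'k :: comm_ring_1) * g)"
proof -
  have "f * (nc_const b * g) = nc_const b * (f * g)"
    unfolding mult.assoc[symmetric] nc_const_commute ..
  then show ?thesis
    by (simp only: nc_const_mult mult.assoc)
qed

lemma nc_subst_cong:
  assumes "p \<in> nc_polys Y" and "\<And>y. y \<in> Y \<Longrightarrow> s y = t y"
  shows "nc_subst s p = nc_subst t p"
proof -
  have "map s w = map t w" if "w \<in> nc_support p" for w
    using assms that by (auto simp: nc_polys_def)
  then show ?thesis
    unfolding nc_subst_def by (intro sum.cong refl arg_cong2[of _ _ _ _ "(*)"] arg_cong[of _ _ prod_list])
qed

lemma nc_subst_add: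
  assumes "p \<in> nc_polys Y" and "q \<in> nc_polys Y"
  shows "nc_subst s (p + q) = nc_subst s p + nc_subst s q"
  unfolding nc_subst_def
  by (rule sum_support_add)
    (use assms in \<open>simp_all add: finite_support_polys nc_const_0 nc_const_add distrib_right\<close>)

text \<open>Coefficients of the second factor have to pass the monomials of the first, which works
  because constants are central over a commutative ring.\<close>

lemma nc_subst_mult:
  fixes p q :: "('y, 'k :: comm_ring_1) nc_series"
  assumes p: "p \<in> nc_polys Y" and q: "q \<in> nc_polys Y"
  shows "nc_subst s (p * q) = nc_subst s p * nc_subst s q"
proof -
  have "nc_subst s (p * q) = (\<Sum>u\<in>nc_support p. \<Sum>w\<in>nc_support q.
      nc_const (nc_coeff p u * nc_coeff q w) * prod_list (map s (u @ w)))"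
    unfolding nc_subst_def
    by (rule sum_support_mult[where G = "\<lambda>w c. nc_const c * prod_list (map s w)"])
      (use p q in \<open>simp_all add: finite_support_polys nc_const_0 nc_const_add distrib_right\<close>)
  also have "\<dots> = nc_subst s p * nc_subst s q"
    unfolding nc_subst_def sum_product
    by (intro sum.cong refl) (simp add: nc_const_mult_mult)
  finally show ?thesis .
qed

lemma nc_subst_0 [simp]: "nc_subst s 0 = 0"
  by (simp add: nc_subst_def nc_support_def)

lemma nc_subst_sum:
  assumes "\<And>i. i \<in> S \<Longrightarrow> f i \<in> nc_polys Y"
  shows "nc_subst s (\<Sum>i\<in>S. f i) = (\<Sum>i\<in>S. nc_subst s (f i))"
  using assms
proof (induction S rule: infinite_finite_induct)
  case (insert i S)
  then show ?case
    by (simp add: nc_subst_add[of _ Y] sum_in_polys)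
qed simp_all

lemma nc_subst_const [simp]: "nc_subst s (nc_const c) = nc_const c"
proof -
  have "nc_subst s (nc_const c) = (\<Sum>w\<in>{[]}. nc_const (nc_coeff (nc_const c) w) * prod_list (map s w))"
    unfolding nc_subst_def
    by (rule sum_support_superset) (auto simp: nc_support_def nc_coeff_const nc_const_0)
  then show ?thesis
    by (simp add: nc_coeff_const)
qed

lemma nc_subst_var [simp]: "nc_subst s (nc_var y) = s y"
proof -
  have "nc_subst s (nc_var y) = (\<Sum>w\<in>{[y]}. nc_const (nc_coeff (nc_var y) w) * prod_list (map s w))"
    unfolding nc_subst_def
    by (rule sum_support_superset) (auto simp: nc_support_def nc_coeff_var nc_const_0)
  then show ?thesis
    by (simp add: nc_coeff_var nc_const_1)
qed

section \<open>Renaming of unknowns and combination of algebraic systems\<close>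

definition nc_rename :: "('y \<Rightarrow> 'z) \<Rightarrow> ('y, 'k) nc_series \<Rightarrow> ('z, 'k :: comm_ring_1) nc_series"
  where "nc_rename \<alpha> = nc_subst (\<lambda>y. nc_var (\<alpha> y))"

lemma prod_list_vars_poly: "set w \<subseteq> Y \<Longrightarrow> prod_list (map nc_var w) \<in> nc_polys Y"
  by (induction w) (auto simp: nc_polys_1 intro: nc_polys_mult nc_var_poly)

lemma nc_coeff_prod_list_vars:
  "nc_coeff (prod_list (map nc_var u) :: ('y, 'k :: ring_1) nc_series) w = (if w = u then 1 else 0)"
proof (induction u arbitrary: w)
  case Nil
  show ?case
    by (simp add: one_nc_series_def)
next
  case (Cons y u)
  have "nc_coeff (nc_var y * prod_list (map nc_var u) :: ('y, 'k) nc_series) w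
      = (\<Sum>i\<le>length w. if i = 1 then (if w = y # u then 1 else 0) else 0)"
    unfolding nc_coeff_mult
  proof (intro sum.cong refl)
    fix i assume "i \<in> {..length w}"
    then show "nc_coeff (nc_var y) (take i w) * nc_coeff (prod_list (map nc_var u) :: ('y, 'k) nc_series) (drop i w)
        = (if i = 1 then (if w = y # u then 1 else 0) else 0)"
      by (cases w; cases i; cases "i - 1") (auto simp: nc_coeff_var Cons.IH)
  qed
  then show ?case
    by (simp only: sum.delta finite_atMost) (cases w; simp)
qed

lemma nc_rename_poly:
  assumes "p \<in> nc_polys Y" and "\<alpha> ` Y \<subseteq> Z"
  shows "nc_rename \<alpha> p \<in> nc_polys Z"
  unfolding nc_rename_def nc_subst_def
proof (intro sum_in_polys nc_polys_mult nc_const_poly)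
  fix w assume "w \<in> nc_support p"
  then have "set (map \<alpha> w) \<subseteq> Z"
    using assms by (auto simp: nc_polys_def)
  from prod_list_vars_poly[OF this] show "prod_list (map (\<lambda>y. nc_var (\<alpha> y)) w) \<in> nc_polys Z"
    by (simp add: o_def)
qed

lemma nc_coeff_rename:
  fixes \<alpha> :: "'y \<Rightarrow> 'z" and p :: "('y, 'k :: comm_ring_1) nc_series"
  shows "nc_coeff (nc_rename \<alpha> p) w = (\<Sum>u\<in>nc_support p. if w = map \<alpha> u then nc_coeff p u else 0)"
proof -
  have sum: "nc_coeff (\<Sum>u\<in>S. f u) w = (\<Sum>u\<in>S. nc_coeff (f u) w)"
    for S and f :: "'y list \<Rightarrow> ('z, 'k) nc_series"
    by (induction S rule: infinite_finite_induct) simp_all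
  have "prod_list (map (\<lambda>y. nc_var (\<alpha> y)) u) = (prod_list (map nc_var (map \<alpha> u)) :: ('z, 'k) nc_series)" for u
    by (simp add: o_def)
  then show ?thesis
    unfolding nc_rename_def nc_subst_def sum nc_coeff_const_mult
    by (intro sum.cong) (simp_all add: nc_coeff_prod_list_vars del: map_map)
qed

lemma nc_subst_rename:
  assumes "p \<in> nc_polys Y"
  shows "nc_subst s (nc_rename \<alpha> p) = nc_subst (\<lambda>y. s (\<alpha> y)) p"
proof -
  have prod: "prod_list (map (\<lambda>y. nc_var (\<alpha> y)) w) \<in> nc_polys UNIV" for w
    using prod_list_vars_poly[of "map \<alpha> w" UNIV] by (simp add: o_def)
  have subst_prod: "nc_subst s (prod_list (map (\<lambda>y. nc_var (\<alpha> y)) w)) = prod_list (map (\<lambda>y. s (\<alpha> y)) w)" for w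
  proof (induction w)
    case Nil
    show ?case
      using nc_subst_const[of s 1] by (simp add: nc_const_1)
  next
    case (Cons y w)
    then show ?case
      using nc_subst_mult[OF nc_var_poly[OF UNIV_I] prod, of s "\<alpha> y" w] by simp
  qed
  have "nc_subst s (nc_rename \<alpha> p) = (\<Sum>w\<in>nc_support p.
      nc_subst s (nc_const (nc_coeff p w) * prod_list (map (\<lambda>y. nc_var (\<alpha> y)) w)))"
    unfolding nc_rename_def nc_subst_def[of "\<lambda>y. nc_var (\<alpha> y)" p]
    by (rule nc_subst_sum[where Y = UNIV]) (intro nc_polys_mult nc_const_poly prod)
  also have "\<dots> = nc_subst (\<lambda>y. s (\<alpha> y)) p"
    unfolding nc_subst_def[of "\<lambda>y. s (\<alpha> y)" p]
    by (intro sum.cong refl) (simp add: nc_subst_mult[OF nc_const_poly prod] subst_prod)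
  finally show ?thesis .
qed

text \<open>The condition on a single right-hand side of a system in \<open>m\<close> unknowns; it
  is kept under sums, constant multiples and renumbering of unknowns, from which larger systems are
  assembled.\<close>

definition proper_poly :: "nat \<Rightarrow> (nat + 'x, 'k :: ring_1) nc_series \<Rightarrow> bool"
  where "proper_poly m p \<longleftrightarrow> p \<in> nc_polys (Inl ` {..<m} \<union> range Inr) \<and> nc_constant_term p = 0 \<and>
    (\<forall>j<m. nc_coeff p [Inl j] = 0)"

lemma algebraic_system_iff: "algebraic_system m \<phi> \<longleftrightarrow> (\<forall>i<m. proper_poly m (\<phi> i))"
  by (simp add: algebraic_system_def proper_poly_def)

lemma proper_poly_add: "proper_poly m p \<Longrightarrow> proper_poly m q \<Longrightarrow> proper_poly m (p + q)"
  by (simp add: proper_poly_def nc_polys_add)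

lemma proper_poly_const_mult: "proper_poly m p \<Longrightarrow> proper_poly m (nc_const c * p)"
  by (simp add: proper_poly_def nc_polys_mult nc_const_poly)

lemma proper_poly_rename:
  assumes p: "proper_poly m p" and f: "\<And>i. i < m \<Longrightarrow> f i < M"
  shows "proper_poly M (nc_rename (map_sum f id) p)"
proof -
  let ?Y = "Inl ` {..<m} \<union> range Inr"
  have Y: "p \<in> nc_polys ?Y" and p0: "nc_coeff p [] = 0" and p1: "\<And>j. j < m \<Longrightarrow> nc_coeff p [Inl j] = 0"
    using p by (auto simp: proper_poly_def)
  have "nc_rename (map_sum f id) p \<in> nc_polys (Inl ` {..<M} \<union> range Inr)"
    by (rule nc_rename_poly[OF Y]) (auto simp: f)
  moreover have "nc_coeff (nc_rename (map_sum f id) p) [] = 0"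
    unfolding nc_coeff_rename by (intro sum.neutral) (simp add: p0)
  moreover have "nc_coeff (nc_rename (map_sum f id) p) [Inl j] = 0" for j
    unfolding nc_coeff_rename
  proof (intro sum.neutral ballI)
    fix u assume u: "u \<in> nc_support p"
    \<comment> \<open>Renaming preserves the length of words and the kind of variable, so a linear
      term in an unknown can only come from such a term of \<open>p\<close>.\<close>
    have "nc_coeff p u = 0" if "[Inl j] = map (map_sum f id) u"
    proof -
      from that obtain y where y: "u = [y]" "Inl j = map_sum f id y"
        by auto
      moreover have "y \<in> ?Y"
        using u Y y(1) by (auto simp: nc_polys_def)
      ultimately show ?thesis
        by (auto simp: p1)
    qed
    then show "(if [Inl j] = map (map_sum f id) u then nc_coeff p u else 0) = 0"
      by simp
  qed
  ultimately show ?thesis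
    by (simp add: proper_poly_def)
qed

lemma proper_poly_var_mult_var:
  assumes "i < m" and "j < m"
  shows "proper_poly m (nc_var (Inl i) * nc_var (Inl j))"
  using assms by (auto simp: proper_poly_def nc_coeff_mult nc_coeff_var intro!: nc_polys_mult nc_var_poly)

definition algebraic_part :: "('x, 'k :: ring_1) nc_series \<Rightarrow> bool"
  where "algebraic_part f \<longleftrightarrow> (\<exists>m \<phi> u. m \<ge> 1 \<and> algebraic_system m \<phi> \<and> solves_algebraic_system m \<phi> u \<and> f = u 0)"

lemma nc_algebraic_closure_iff:
  "f \<in> nc_algebraic_closure \<longleftrightarrow> (\<exists>c g. algebraic_part g \<and> f = nc_const c + g)"
  unfolding nc_algebraic_closure_def algebraic_part_def by blast

text \<open>
  The systems of two solutions are put side by side, with one new unknown in front whose equation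
  avoids linear terms because the unknowns in \<open>a * u 0 + b * v 0\<close> are replaced by the right-hand sides
  of their equations.
\<close>

lemma algebraic_part_combine:
  fixes f g :: "('x, 'k :: comm_ring_1) nc_series"
  assumes "algebraic_part f" and "algebraic_part g"
  shows "algebraic_part (nc_const a * f + nc_const b * g + nc_const c * (f * g))"
proof -
  from assms obtain m \<phi> u m' \<psi> v where m: "m \<ge> 1" "algebraic_system m \<phi>" "solves_algebraic_system m \<phi> u" "f = u 0"
    and m': "m' \<ge> 1" "algebraic_system m' \<psi>" "solves_algebraic_system m' \<psi> v" "g = v 0"
    unfolding algebraic_part_def by blast
  \<comment> \<open>Index \<open>0\<close> is the new unknown, \<open>1\<close> to \<open>m\<close>
    are those of the first system, and \<open>Suc m\<close> to \<open>m + m'\<close> those of the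
    second.\<close>
  define M where "M = Suc (m + m')"
  define \<alpha> \<beta> :: "nat + 'x \<Rightarrow> nat + 'x" where "\<alpha> = map_sum Suc id" and "\<beta> = map_sum (\<lambda>i. Suc (m + i)) id"
  \<comment> \<open>The unknowns \<open>1\<close> and \<open>Suc m\<close> stand for
    \<open>u 0\<close> and \<open>v 0\<close>. Their product has degree two and may stay as it is;
    only the linear part needs the right-hand sides \<open>\<phi> 0\<close> and
    \<open>\<psi> 0\<close>.\<close>
  define \<chi> where "\<chi> i =
    (if i = 0 then nc_const a * nc_rename \<alpha> (\<phi> 0) + nc_const b * nc_rename \<beta> (\<psi> 0)
        + nc_const c * (nc_var (Inl 1) * nc_var (Inl (Suc m)))
     else if i \<le> m then nc_rename \<alpha> (\<phi> (i - 1)) else nc_rename \<beta> (\<psi> (i - Suc m)))" for i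
  define U where "U i = (if i = 0 then nc_const a * f + nc_const b * g + nc_const c * (f * g)
     else if i \<le> m then u (i - 1) else v (i - Suc m))" for i
  have \<phi>: "proper_poly m (\<phi> i)" if "i < m" for i
    using m(2) that by (simp add: algebraic_system_iff)
  have \<psi>: "proper_poly m' (\<psi> i)" if "i < m'" for i
    using m'(2) that by (simp add: algebraic_system_iff)
  have \<alpha>: "proper_poly M (nc_rename \<alpha> (\<phi> i))" if "i < m" for i
    unfolding \<alpha>_def by (rule proper_poly_rename[OF \<phi>[OF that]]) (simp add: M_def)
  have \<beta>: "proper_poly M (nc_rename \<beta> (\<psi> i))" if "i < m'" for i
    unfolding \<beta>_def by (rule proper_poly_rename[OF \<psi>[OF that]]) (simp add: M_def)
  have uv: "proper_poly M (nc_var (Inl 1) * nc_var (Inl (Suc m)))"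
    by (rule proper_poly_var_mult_var) (use m(1) m'(1) in \<open>auto simp: M_def\<close>)
  have \<chi>0: "proper_poly M (nc_const a * nc_rename \<alpha> (\<phi> 0))" "proper_poly M (nc_const b * nc_rename \<beta> (\<psi> 0))"
    "proper_poly M (nc_const c * (nc_var (Inl 1) * nc_var (Inl (Suc m))))"
    using \<alpha>[of 0] \<beta>[of 0] uv m(1) m'(1) by (auto intro: proper_poly_const_mult)
  have "proper_poly M (\<chi> i)" if "i < M" for i
    using that \<chi>0 \<alpha> \<beta> by (auto simp: \<chi>_def M_def intro!: proper_poly_add)
  then have system: "algebraic_system M \<chi>"
    by (simp add: algebraic_system_iff)
  let ?s = "case_sum U nc_var"
  have subst_\<alpha>: "nc_subst ?s (nc_rename \<alpha> (\<phi> i)) = u i" if "i < m" for i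
  proof -
    have poly: "\<phi> i \<in> nc_polys (Inl ` {..<m} \<union> range Inr)"
      using \<phi>[OF that] by (simp add: proper_poly_def)
    have "nc_subst ?s (nc_rename \<alpha> (\<phi> i)) = nc_subst (\<lambda>y. ?s (\<alpha> y)) (\<phi> i)"
      by (rule nc_subst_rename[OF poly])
    also have "\<dots> = nc_subst (case_sum u nc_var) (\<phi> i)"
      by (rule nc_subst_cong[OF poly]) (auto simp: \<alpha>_def U_def)
    also have "\<dots> = u i"
      using m(3) that by (simp add: solves_algebraic_system_def)
    finally show ?thesis .
  qed
  have subst_\<beta>: "nc_subst ?s (nc_rename \<beta> (\<psi> i)) = v i" if "i < m'" for i
  proof -
    have poly: "\<psi> i \<in> nc_polys (Inl ` {..<m'} \<union> range Inr)"
      using \<psi>[OF that] by (simp add: proper_poly_def)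
    have "nc_subst ?s (nc_rename \<beta> (\<psi> i)) = nc_subst (\<lambda>y. ?s (\<beta> y)) (\<psi> i)"
      by (rule nc_subst_rename[OF poly])
    also have "\<dots> = nc_subst (case_sum v nc_var) (\<psi> i)"
      by (rule nc_subst_cong[OF poly]) (auto simp: \<beta>_def U_def)
    also have "\<dots> = v i"
      using m'(3) that by (simp add: solves_algebraic_system_def)
    finally show ?thesis .
  qed
  have "nc_subst ?s (\<chi> 0) = U 0"
  proof -
    let ?Y = "Inl ` {..<M} \<union> range Inr"
    have poly: "nc_rename \<alpha> (\<phi> 0) \<in> nc_polys ?Y" "nc_rename \<beta> (\<psi> 0) \<in> nc_polys ?Y"
      "nc_var (Inl 1) * nc_var (Inl (Suc m)) \<in> nc_polys ?Y"
      "nc_var (Inl 1) \<in> nc_polys ?Y" "nc_var (Inl (Suc m)) \<in> nc_polys ?Y"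
      using \<alpha>[of 0] \<beta>[of 0] uv m(1) m'(1) by (auto simp: proper_poly_def M_def intro!: nc_var_poly)
    note S = nc_subst_add[where Y = ?Y] nc_subst_mult[where Y = ?Y]
    have "nc_subst ?s (\<chi> 0) = nc_const a * u 0 + nc_const b * v 0 + nc_const c * (U 1 * U (Suc m))"
      using subst_\<alpha>[of 0] subst_\<beta>[of 0] m(1) m'(1)
      by (simp add: \<chi>_def S poly nc_polys_add nc_polys_mult nc_const_poly del: One_nat_def)
    then show ?thesis
      using m(1) by (simp add: U_def m(4) m'(4))
  qed
  then have "nc_subst ?s (\<chi> i) = U i" if "i < M" for i
    using that subst_\<alpha> subst_\<beta> by (cases "i = 0") (auto simp: \<chi>_def U_def M_def)
  moreover have "nc_constant_term (U i) = 0" if "i < M" for i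
  proof -
    have u0: "nc_constant_term (u j) = 0" if "j < m" for j
      using m(3) that unfolding solves_algebraic_system_def by blast
    have v0: "nc_constant_term (v j) = 0" if "j < m'" for j
      using m'(3) that unfolding solves_algebraic_system_def by blast
    show ?thesis
      using that m(1) m'(1) u0 v0 by (auto simp: U_def M_def nc_coeff_mult[of "u 0"] m(4) m'(4))
  qed
  ultimately have "solves_algebraic_system M \<chi> U"
    by (simp add: solves_algebraic_system_def)
  with system show ?thesis
    unfolding algebraic_part_def by (intro exI[of _ M] exI[of _ \<chi>] exI[of _ U]) (simp add: M_def U_def)
qed

lemma algebraic_part_0: "algebraic_part 0"
  unfolding algebraic_part_def
  by (intro exI[of _ 1] exI[of _ "\<lambda>_. 0"])
    (simp add: algebraic_system_iff solves_algebraic_system_def proper_poly_def nc_polys_0)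

lemma algebraic_part_var: "algebraic_part (nc_var x)"
proof -
  have "algebraic_system 1 (\<lambda>_. nc_var (Inr x))"
    by (simp add: algebraic_system_iff proper_poly_def nc_coeff_var nc_var_poly)
  moreover have "solves_algebraic_system 1 (\<lambda>_. nc_var (Inr x)) (\<lambda>_. nc_var x)"
    by (simp add: solves_algebraic_system_def nc_coeff_var)
  ultimately show ?thesis
    unfolding algebraic_part_def by (intro exI[of _ 1] exI conjI) auto
qed

lemma nc_var_algebraic_closure: "nc_var x \<in> nc_algebraic_closure"
  unfolding nc_algebraic_closure_iff
  by (intro exI[of _ 0] exI[of _ "nc_var x"]) (simp add: algebraic_part_var nc_const_0)

lemma nc_subalgebra_algebraic_closure:
  "nc_subalgebra (nc_algebraic_closure :: ('x, 'k :: comm_ring_1) nc_series set)"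
proof -
  have "nc_const c \<in> nc_algebraic_closure" for c :: 'k
    unfolding nc_algebraic_closure_iff
    by (intro exI[of _ c] exI[of _ 0]) (simp add: algebraic_part_0)
  moreover have "f + g \<in> nc_algebraic_closure \<and> f * g \<in> nc_algebraic_closure"
    if "f \<in> nc_algebraic_closure" "g \<in> nc_algebraic_closure" for f g :: "('x, 'k) nc_series"
  proof -
    from that obtain c d f' g' where f: "algebraic_part f'" "f = nc_const c + f'"
      and g: "algebraic_part g'" "g = nc_const d + g'"
      unfolding nc_algebraic_closure_iff by blast
    \<comment> \<open>Once the constants are split off, sum and product are both of the form
      provided by \<open>algebraic_part_combine\<close>, with coefficients \<open>1, 1, 0\<close>
      and \<open>d, c, 1\<close>.\<close>
    have "f + g = nc_const (c + d) + (nc_const 1 * f' + nc_const 1 * g' + nc_const 0 * (f' * g'))"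
      by (simp add: f g nc_const_add nc_const_0 nc_const_1)
    moreover have "f * g = nc_const (c * d) + (nc_const d * f' + nc_const c * g' + nc_const 1 * (f' * g'))"
      by (simp add: f g nc_const_mult nc_const_1 distrib_left distrib_right nc_const_commute[of f'])
    ultimately show ?thesis
      using algebraic_part_combine[OF f(1) g(1)] unfolding nc_algebraic_closure_iff by blast
  qed
  ultimately show ?thesis
    unfolding nc_subalgebra_def by blast
qed

theorem corollary5p3:
  assumes "CARD('x :: finite) \<ge> 2"
  shows "has_module_type
           (leavitt_localization (nc_rational_closure :: ('x, 'k :: comm_ring_1) nc_series set))
           1 CARD('x)
    \<and> has_module_type
           (leavitt_localization (nc_algebraic_closure :: ('x, 'k) nc_series set))
           1 CARD('x)"
proof -
  have rational: "leavitt_base (nc_rational_closure :: ('x, 'k) nc_series set)"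
    by standard (rule nc_subalgebra_rational_closure nc_var_rational_closure)+
  have algebraic: "leavitt_base (nc_algebraic_closure :: ('x, 'k) nc_series set)"
    by standard (rule nc_subalgebra_algebraic_closure nc_var_algebraic_closure)+
  show ?thesis
    using leavitt_base.module_type[OF rational assms] leavitt_base.module_type[OF algebraic assms] ..
qed

end
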